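(* Let $(P_-,P_+)$ be a pair of polygons with filled set of vertices $F=F_-\sqcup F_+$. If $F$ is finite, then every symplectic billiard orbit on the phase space $\mathcal{P}$ is periodic, and all periods are bounded by $4\,|F_-|\,|F_+|$.
   Context: Polygons. Let $v_1,\dots,v_n\in\mathbb{R}^2$ be pairwise distinct (indices read cyclically) such that any two distinct open segments $v_iv_{i+1}$, $v_jv_{j+1}$ do not intersect, no open segment $v_jv_{j+1}$ contains any $v_i$, and no three consecutive $v_i,v_{i+1},v_{i+2}$ are collinear. The union $P$ of the closed segments $\overline{v_iv_{i+1}}$ is a polygon (not necessarily convex) with vertex set $V=\{v_1,\dots,v_n\}$ and (open) edges $v_iv_{i+1}$. $\mathrm{int}(P)$ is the bounded component of $\mathbb{R}^2\setminus P$. For points $a,b$, $ab$ denotes the open segment between them. For $x\in P\setminus V$, $T_xP\subset\mathbb{R}^2$ is the linear line parallel to the edge containing $x$. Pairs. $(P_-,P_+)$ is a pair of polygons (possibly equal) with vertex sets $V_-,V_+$; $P_-\sqcup P_+$ is the formal disjoint union. The notation $P_\pm,P_\mp$ indicates a choice of sign and its opposite. A pair $(x,y)\in P_\pm\times P_\mp$ satisfies condition A if $y\notin V_\mp$ and there is exactly one $z\in P_\pm\cap\{x+t: t\in T_yP_\mp, t\neq 0\}$ with $xz\subset\mathrm{int}(P_\pm)$. Let $\mathcal{P}_{\max}$ be the set of $(x,y)\in(P_-\times P_+)\sqcup(P_+\times P_-)$ satisfying condition A. The symplectic billiard map is $\phi:\mathcal{P}_{\max}\to(P_-\times P_+)\sqcup(P_+\times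 P_-)$, $\phi(x,y)=(y,z)$ with this $z$. Phase space. Let $\sigma(x,y)=(y,x)$, $N_0=(P_-\times V_+)\sqcup(P_+\times V_-)$, $N_{i+1}=\phi^{-1}(N_i)$ (preimage) for $i\ge 0$, and $N=\bigcup_{i\ge0}N_i\cup\sigma(\bigcup_{i\ge0}N_i)$. The phase space is $\mathcal{P}=\mathcal{P}_{\max}\setminus N$; $\phi$ restricts to a bijection of $\mathcal{P}$. The orbit of $(x_0,x_1)\in\mathcal{P}$ is $(\phi^k(x_0,x_1))_{k\in\mathbb{Z}}$; it is periodic if $\phi^n(x_0,x_1)=(x_0,x_1)$ for some $n\ge1$, and the least such $n$ is its period. Filled set of vertices. Set $V_0^\pm=V_\pm$ and, for $i\ge1$, let $V_i^\pm$ be the set of $v\in P_\pm$ for which there exists $w\in V_{i-1}^\pm$ such that the open segment $vw$ satisfies $vw\subset\mathrm{int}(P_\pm)$ and $vw$ is parallel to an edge of $P_\mp$. Then $F_\pm=\bigcup_{i\ge0}V_i^\pm$ and $F=F_-\sqcup F_+$. *)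

theory Defs
  imports "HOL-Analysis.Analysis"
begin

text \<open>A polygon is represented by the cyclic list of its vertices.\<close>

definition vtx :: "(real^2) list \<Rightarrow> nat \<Rightarrow> real^2" where
  "vtx vs i = vs ! (i mod length vs)"

definition edge :: "(real^2) list \<Rightarrow> nat \<Rightarrow> (real^2) set" where
  "edge vs i = open_segment (vtx vs i) (vtx vs (i + 1))"

definition edge_vec :: "(real^2) list \<Rightarrow> nat \<Rightarrow> real^2" where
  "edge_vec vs i = vtx vs (i + 1) - vtx vs i"

text \<open>Non-collinearity of consecutive vertices rules out one or two vertices; only the empty
  list has to be excluded explicitly.\<close>

definition is_polygon :: "(real^2) list \<Rightarrow> bool" where
  "is_polygon vs \<longleftrightarrow> vs \<noteq> [] \<and> distinct vs \<and>
     (\<forall>i<length vs. \<forall>j<length vs. i \<noteq> j \<longrightarrow> edge vs i \<inter> edge vs j = {}) \<and>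
     (\<forall>i<length vs. \<forall>j<length vs. vtx vs i \<notin> edge vs j) \<and>
     (\<forall>i<length vs. \<not> collinear {vtx vs i, vtx vs (i + 1), vtx vs (i + 2)})"

definition poly_set :: "(real^2) list \<Rightarrow> (real^2) set" where
  "poly_set vs = (\<Union>i<length vs. closed_segment (vtx vs i) (vtx vs (i + 1)))"

text \<open>\<^const>\<open>inside\<close> is the union of the bounded components of the complement; for a polygon
  there is exactly one.\<close>

definition poly_int :: "(real^2) list \<Rightarrow> (real^2) set" where
  "poly_int vs = inside (poly_set vs)"

text \<open>Only meaningful for \<open>x\<close> on the polygon and not a vertex, where exactly one index \<open>i\<close>
  contributes.\<close>

definition tangent_line :: "(real^2) list \<Rightarrow> real^2 \<Rightarrow> (real^2) set" where
  "tangent_line vs x = (\<Union>i\<in>{i. i < length vs \<and> x \<in> edge vs i}. span {edge_vec vs i})"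

datatype sign = Minus | Plus

primrec opp :: "sign \<Rightarrow> sign" where
  "opp Minus = Plus"
| "opp Plus = Minus"

text \<open>A pair of polygons is a sign-indexed family \<open>W\<close> of vertex lists.  The triple \<open>(s, x, y)\<close>
  is the element \<open>(x, y)\<close> of the summand with \<open>x\<close> on the polygon of sign \<open>s\<close> and \<open>y\<close> on the
  other one; the tag makes the union of the two products disjoint.\<close>

type_synonym pair = "sign \<Rightarrow> (real^2) list"
type_synonym state = "sign \<times> (real^2) \<times> (real^2)"

definition hits :: "pair \<Rightarrow> sign \<Rightarrow> real^2 \<Rightarrow> real^2 \<Rightarrow> real^2 \<Rightarrow> bool" where
  "hits W s x y z \<longleftrightarrow>
     z \<in> poly_set (W s) \<inter> {x + t |t. t \<in> tangent_line (W (opp s)) y \<and> t \<noteq> 0} \<and>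
     open_segment x z \<subseteq> poly_int (W s)"

definition condition_A :: "pair \<Rightarrow> sign \<Rightarrow> real^2 \<Rightarrow> real^2 \<Rightarrow> bool" where
  "condition_A W s x y \<longleftrightarrow> y \<notin> set (W (opp s)) \<and> (\<exists>!z. hits W s x y z)"

definition P_max :: "pair \<Rightarrow> state set" where
  "P_max W = {(s, x, y). x \<in> poly_set (W s) \<and> y \<in> poly_set (W (opp s)) \<and> condition_A W s x y}"

text \<open>A total function, meaningful only on \<^const>\<open>P_max\<close>.\<close>

definition billiard :: "pair \<Rightarrow> state \<Rightarrow> state" where
  "billiard W = (\<lambda>(s, x, y). (opp s, y, THE z. hits W s x y z))"

definition flip :: "state \<Rightarrow> state" where
  "flip = (\<lambda>(s, x, y). (opp s, y, x))"

text \<open>Since \<^const>\<open>billiard\<close> is total, its preimages are restricted to \<^const>\<open>P_max\<close>.\<close>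

primrec N_step :: "pair \<Rightarrow> nat \<Rightarrow> state set" where
  "N_step W 0 = {(s, x, y). x \<in> poly_set (W s) \<and> y \<in> set (W (opp s))}"
| "N_step W (Suc i) = {p \<in> P_max W. billiard W p \<in> N_step W i}"

definition N_set :: "pair \<Rightarrow> state set" where
  "N_set W = (\<Union>i. N_step W i) \<union> flip ` (\<Union>i. N_step W i)"

definition phase_space :: "pair \<Rightarrow> state set" where
  "phase_space W = P_max W - N_set W"

definition periodic_orbit :: "pair \<Rightarrow> state \<Rightarrow> bool" where
  "periodic_orbit W p \<longleftrightarrow> (\<exists>n\<ge>1. (billiard W ^^ n) p = p)"

definition orbit_period :: "pair \<Rightarrow> state \<Rightarrow> nat" where
  "orbit_period W p = (LEAST n. n \<ge> 1 \<and> (billiard W ^^ n) p = p)"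

primrec V_step :: "pair \<Rightarrow> sign \<Rightarrow> nat \<Rightarrow> (real^2) set" where
  "V_step W s 0 = set (W s)"
| "V_step W s (Suc i) = {v \<in> poly_set (W s). \<exists>w \<in> V_step W s i. v \<noteq> w \<and>
     open_segment v w \<subseteq> poly_int (W s) \<and>
     (\<exists>j<length (W (opp s)). w - v \<in> span {edge_vec (W (opp s)) j})}"

definition filled_part :: "pair \<Rightarrow> sign \<Rightarrow> (real^2) set" where
  "filled_part W s = (\<Union>i. V_step W s i)"

definition filled :: "pair \<Rightarrow> (sign \<times> (real^2)) set" where
  "filled W = (SIGMA s : UNIV. filled_part W s)"

end

theory Submission
  imports Defs
begin

text \<open>Cut both polygons at their filled points.  A chord issuing from an open cell never ends in a
  vertex, so the end edge is constant along the cell, and translation along the fixed direction maps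
  the cell affinely onto another cell.  Hence the billiard map permutes finitely many products of cells
  injectively, and after \<open>m \<le> 2 |F\<^sub>-| |F\<^sub>+|\<close> steps an orbit is back in its initial product.  An affine
  bijection of an interval onto itself is the identity or the reflection in its midpoint, so after
  \<open>2 m\<close> steps the orbit is closed.  That a nonvertex point has exactly one chord in each transversal
  direction is where the Jordan curve theorem enters.\<close>

text \<open>An orbit is one sequence of points, and each point after the second arises by projecting
  the point two places earlier along the edge of the point between. The direction depends only on
  the cell of the middle point, so pairs of cells have well defined successors and, chords being
  symmetric, predecessors. Predecessors matter because the pigeonhole principle finds a repetition
  somewhere along the orbit, not at its start. The constant: each filled point labels itself and
  also the open cell that begins there. Telling the two apart would cost a factor 4. It is saved
  because chords preserve membership in F, so filledness is constant along indices of equal parity,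
  and equal labels have equal sign, hence an even distance. The sign in the label gives the 2 in the
  bound for m; the second 2 pays for a possible reflection. No composite of cell maps is formed. The
  distance to the cell centre relative to the cell length is invariant, so a return to the cell is
  to the same point or to its mirror image. This alternative persists along the orbit, and after m
  more steps it cancels with itself. The two points of a state may fall under different
  alternatives.\<close>

section \<open>The Jordan curve theorem in \<open>real^2\<close>\<close>

text \<open>Both sets are defined by components of the complement and their boundedness, and a
  linear bijection preserves components and boundedness in both directions. This moves the Jordan
  curve theorem from \<open>complex\<close> to \<open>real^2\<close>.\<close>

lemma inside_bij_linear_image:
  fixes f :: "'a::euclidean_space \<Rightarrow> 'b::euclidean_space"
  assumes "linear f" "bij f"
  shows "inside (f ` S) = f ` inside S" "outside (f ` S) = f ` outside S"
proof -
  obtain g where g: "linear g" "g \<circ> f = id" "f \<circ> g = id"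
  proof -
    obtain g where g: "linear g" "g \<circ> f = id"
      using linear_injective_left_inverse[OF assms(1) bij_is_inj[OF assms(2)]] by blast
    then have "f (g y) = y" for y
      using bij_is_surj[OF assms(2)] by (metis pointfree_idE surj_def)
    then show ?thesis using g that by (simp add: fun_eq_iff)
  qed
  have hom: "homeomorphism (- S) (- (f ` S)) f g"
  proof (rule homeomorphismI)
    show "continuous_on (- S) f" "continuous_on (- f ` S) g"
      using assms(1) g(1) by (simp_all add: linear_continuous_on linear_conv_bounded_linear)
    have gf: "g (f x) = x" "f (g y) = y" for x y
      using g by (simp_all add: fun_eq_iff)
    show "g (f x) = x" "f (g y) = y" for x y
      by (rule gf)+
    show "f ` (- S) \<subseteq> - f ` S"
      by (auto, metis gf(1))
    show "g ` (- f ` S) \<subseteq> - S"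
      by (auto, metis gf(2) image_eqI)
  qed
  have bd: "bounded (f ` T) \<longleftrightarrow> bounded T" for T
  proof
    assume "bounded (f ` T)"
    then have "bounded (g ` f ` T)"
      using g(1) bounded_linear_image linear_conv_bounded_linear by blast
    then show "bounded T" by (simp add: image_comp g(2))
  next
    assume "bounded T"
    then show "bounded (f ` T)"
      using assms(1) bounded_linear_image linear_conv_bounded_linear by blast
  qed
  have cc: "connected_component_set (- f ` S) (f x) = f ` connected_component_set (- S) x" if "x \<notin> S" for x
    using connected_component_set_homeomorphism[OF hom] that by auto
  have inj: "inj f" using assms bij_is_inj by auto
  have 1: "f x \<in> outside (f ` S) \<longleftrightarrow> x \<in> outside S" for x
    using cc[of x] bd inj by (auto simp: outside_def inj_image_mem_iff)
  have 2: "f x \<in> inside (f ` S) \<longleftrightarrow> x \<in> inside S" for x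
    using cc[of x] bd inj by (auto simp: inside_def inj_image_mem_iff)
  have 3: "f (g y) = y" for y
    using g(3) by (simp add: fun_eq_iff)
  show "outside (f ` S) = f ` outside S"
    using 1 by (auto, metis 3 image_eqI)
  show "inside (f ` S) = f ` inside S"
    using 2 by (auto, metis 3 image_eqI)
qed

text \<open>Two consequences are drawn from these frontiers: both sides accumulate at every point of
  the curve, and a ray that leaves the inside does so at a point of the curve.\<close>

lemma Jordan_frontiers_real2:
  fixes c :: "real \<Rightarrow> real^2"
  assumes "simple_path c" "pathfinish c = pathstart c"
  shows "frontier (inside (path_image c)) = path_image c"
    and "frontier (outside (path_image c)) = path_image c"
proof -
  define f :: "real^2 \<Rightarrow> complex" where "f v = Complex (v $ 1) (v $ 2)" for v
  have lin: "linear f"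
    by (rule linearI) (auto simp: f_def complex_eq_iff)
  have bij: "bij f"
  proof (rule bijI)
    show "inj f" by (auto simp: inj_def f_def vec_eq_iff forall_2)
    have "z = f (vector [Re z, Im z])" for z
      by (simp add: f_def vector_2)
    then show "surj f" by blast
  qed
  have s: "simple_path (f \<circ> c)"
    using assms(1) lin bij bij_is_inj simple_path_linear_image_eq by blast
  have l: "pathfinish (f \<circ> c) = pathstart (f \<circ> c)"
    using assms(2) by (simp add: pathfinish_def pathstart_def)
  note J = Jordan_inside_outside[OF s l]
  have fr: "frontier (f ` T) = f ` frontier T" for T
    unfolding frontier_def
    using closure_injective_linear_image[OF lin] interior_bijective_linear_image[OF lin bij] bij
    by (simp add: bij_is_inj image_set_diff)
  have i: "f ` T = f ` U \<longleftrightarrow> T = U" for T U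
    using bij by (simp add: bij_is_inj inj_image_eq_iff)
  show "frontier (inside (path_image c)) = path_image c"
    "frontier (outside (path_image c)) = path_image c"
    using J by (simp_all add: path_image_compose inside_bij_linear_image[OF lin bij] fr i)
qed

section \<open>A polygon as a simple closed curve\<close>

locale polygon =
  fixes vs :: "(real^2) list"
  assumes is_poly: "is_polygon vs"
begin

abbreviation "n \<equiv> length vs"
abbreviation "cedge i \<equiv> closed_segment (vtx vs i) (vtx vs (i + 1))"

lemma n_pos: "0 < n"
  using is_poly by (auto simp: is_polygon_def)

lemma vtx_in: "vtx vs i \<in> set vs"
  using n_pos by (simp add: vtx_def)

lemma vtx_eq_iff: "vtx vs i = vtx vs j \<longleftrightarrow> i mod n = j mod n"
  using is_poly n_pos by (auto simp: is_polygon_def vtx_def nth_eq_iff_index_eq)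

lemma vtx_Suc_neq:
  assumes "i < n"
  shows "vtx vs i \<noteq> vtx vs (Suc i)"
proof
  assume "vtx vs i = vtx vs (Suc i)"
  then have "collinear {vtx vs i, vtx vs (i + 1), vtx vs (i + 2)}"
    by (simp add: collinear_2)
  then show False using is_poly assms by (auto simp: is_polygon_def)
qed

lemma n_ge2: "2 \<le> n"
proof (rule ccontr)
  assume "\<not> 2 \<le> n"
  then have "n = 1" using n_pos by linarith
  then have "vtx vs 0 = vtx vs (Suc 0)" by (simp add: vtx_def)
  then show False using vtx_Suc_neq n_pos by blast
qed

lemma edge_vec_nz: "i < n \<Longrightarrow> edge_vec vs i \<noteq> 0"
  using vtx_Suc_neq[of i] by (simp add: edge_vec_def)

lemma cedge_eq: "cedge i = edge vs i \<union> {vtx vs i, vtx vs (Suc i)}"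
  by (simp add: edge_def closed_segment_eq_open)

lemma set_vs: "set vs = vtx vs ` {..<n}"
  by (force simp: vtx_def set_conv_nth)

lemma vtx_notin_edge: "j < n \<Longrightarrow> v \<in> set vs \<Longrightarrow> v \<notin> edge vs j"
  using is_poly unfolding set_vs is_polygon_def by auto

lemma edges_disjoint: "i < n \<Longrightarrow> j < n \<Longrightarrow> x \<in> edge vs i \<Longrightarrow> x \<in> edge vs j \<Longrightarrow> i = j"
  using is_poly unfolding is_polygon_def by blast

lemma cedge_Int:
  assumes "i < n" "j < n" "i \<noteq> j"
  shows "cedge i \<inter> cedge j \<subseteq> {vtx vs i, vtx vs (Suc i)} \<inter> {vtx vs j, vtx vs (Suc j)}"
  using assms vtx_notin_edge[OF _ vtx_in] edges_disjoint unfolding cedge_eq by blast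

text \<open>Below n the vertex indices are distinct modulo n, so the next edge can meet the arc only
  in its last vertex. The edge that returns to vertex 0 is left to
  \<open>ex_simple_path\<close>.\<close>

lemma arc_prefix:
  assumes "1 \<le> k" "k < n"
  shows "\<exists>g. arc g \<and> pathstart g = vtx vs 0 \<and> pathfinish g = vtx vs k \<and> path_image g = (\<Union>i<k. cedge i)"
  using assms
proof (induction k rule: nat_induct_at_least)
  case base
  then show ?case
    using vtx_Suc_neq[of 0] n_pos
    by (intro exI[of _ "linepath (vtx vs 0) (vtx vs 1)"]) (auto simp: arc_linepath)
next
  case (Suc k)
  then obtain g where g: "arc g" "pathstart g = vtx vs 0" "pathfinish g = vtx vs k"
    "path_image g = (\<Union>i<k. cedge i)" by auto
  let ?l = "linepath (vtx vs k) (vtx vs (Suc k))"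
  have "path_image g \<inter> path_image ?l \<subseteq> {vtx vs k}"
  proof
    fix x assume "x \<in> path_image g \<inter> path_image ?l"
    then obtain i where i: "i < k" "x \<in> cedge i" "x \<in> cedge k" by (auto simp: g(4))
    then have "x \<in> {vtx vs i, vtx vs (Suc i)} \<inter> {vtx vs k, vtx vs (Suc k)}"
      using cedge_Int[of i k] Suc.prems by auto
    then show "x \<in> {vtx vs k}" using i Suc.prems by (auto simp: vtx_eq_iff)
  qed
  then have "arc (g +++ ?l)"
    using g vtx_Suc_neq[of k] Suc.prems by (intro arc_join) (auto simp: arc_linepath)
  moreover have "path_image (g +++ ?l) = (\<Union>i<Suc k. cedge i)"
    using g by (auto simp: path_image_join lessThan_Suc)
  ultimately show ?case using g by (intro exI[of _ "g +++ ?l"]) auto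
qed

lemma ex_simple_path:
  "\<exists>c. simple_path c \<and> pathfinish c = pathstart c \<and> path_image c = poly_set vs"
proof -
  define k where "k = n - 1"
  have k: "1 \<le> k" "k < n" "Suc k = n" using n_ge2 by (auto simp: k_def)
  obtain g where g: "arc g" "pathstart g = vtx vs 0" "pathfinish g = vtx vs k"
    "path_image g = (\<Union>i<k. cedge i)" using arc_prefix k by blast
  have v: "vtx vs (Suc k) = vtx vs 0" using k by (simp add: vtx_def)
  let ?l = "linepath (vtx vs k) (vtx vs (Suc k))"
  have "path_image g \<inter> path_image ?l \<subseteq> {vtx vs 0, vtx vs k}"
  proof
    fix x assume "x \<in> path_image g \<inter> path_image ?l"
    then obtain i where i: "i < k" "x \<in> cedge i" "x \<in> cedge k" by (auto simp: g(4))
    then show "x \<in> {vtx vs 0, vtx vs k}"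
      using cedge_Int[of i k] k v by auto
  qed
  then have "simple_path (g +++ ?l)"
    using g vtx_Suc_neq[of k] k v by (intro simple_path_join_loop) (auto simp: arc_linepath)
  moreover have "path_image (g +++ ?l) = poly_set vs"
  proof -
    have "poly_set vs = (\<Union>i<Suc k. cedge i)" by (simp add: poly_set_def k(3))
    then show ?thesis using g by (auto simp: path_image_join lessThan_Suc)
  qed
  ultimately show ?thesis using g v by (intro exI[of _ "g +++ ?l"]) auto
qed

lemma frontier_poly_int: "frontier (poly_int vs) = poly_set vs"
  and frontier_outside: "frontier (outside (poly_set vs)) = poly_set vs"
  using ex_simple_path Jordan_frontiers_real2 unfolding poly_int_def by metis+

lemma compact_poly_set: "compact (poly_set vs)"
  unfolding poly_set_def by (intro compact_UN) auto

lemma closed_poly_set: "closed (poly_set vs)"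
  using compact_poly_set compact_imp_closed by blast

lemma open_poly_int: "open (poly_int vs)"
  unfolding poly_int_def using closed_poly_set by (rule open_inside)

lemma bounded_poly_int: "bounded (poly_int vs)"
  unfolding poly_int_def using compact_poly_set by (simp add: bounded_inside compact_imp_bounded)

lemma poly_int_disjoint: "poly_int vs \<inter> poly_set vs = {}"
  unfolding poly_int_def by simp

end

section \<open>Determinants, edge parameters and chords\<close>

text \<open>The determinant of two plane vectors: its vanishing expresses parallelism, its sign the
  side of an edge.\<close>

definition cross2 :: "real^2 \<Rightarrow> real^2 \<Rightarrow> real" where
  "cross2 u v = u $ 1 * v $ 2 - u $ 2 * v $ 1"

lemma cross2_add_right: "cross2 u (v + w) = cross2 u v + cross2 u w"
  and cross2_diff_right: "cross2 u (v - w) = cross2 u v - cross2 u w"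
  and cross2_scaleR_right: "cross2 u (c *\<^sub>R v) = c * cross2 u v"
  and cross2_self: "cross2 u u = 0"
  and cross2_commute: "cross2 v u = - cross2 u v"
  by (simp_all add: cross2_def algebra_simps)

lemmas cross2_simps = cross2_add_right cross2_diff_right cross2_scaleR_right cross2_self

lemma cross2_eq_0_iff:
  assumes "u \<noteq> 0"
  shows "cross2 u v = 0 \<longleftrightarrow> v \<in> span {u}"
proof
  assume c: "cross2 u v = 0"
  have "u $ 1 \<noteq> 0 \<or> u $ 2 \<noteq> 0"
    using assms by (auto simp: vec_eq_iff forall_2)
  then show "v \<in> span {u}"
  proof
    assume "u $ 1 \<noteq> 0"
    then have "v = (v $ 1 / u $ 1) *\<^sub>R u"
      using c by (auto simp: vec_eq_iff forall_2 cross2_def field_simps)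
    then show ?thesis by (auto simp: span_singleton)
  next
    assume "u $ 2 \<noteq> 0"
    then have "v = (v $ 2 / u $ 2) *\<^sub>R u"
      using c by (auto simp: vec_eq_iff forall_2 cross2_def field_simps)
    then show ?thesis by (auto simp: span_singleton)
  qed
qed (auto simp: span_singleton cross2_simps)

text \<open>\<open>cross2 u\<close> is the inner product with u turned by a right angle, so for
  nonzero c and u this is an open half plane; the sign of c selects the side.\<close>

lemma convex_cross2_pos: "convex {y. 0 < c * cross2 u (y - x)}"
proof -
  have "{y. 0 < c * cross2 u (y - x)} = {y. c * cross2 u x < (c *\<^sub>R vector [- u $ 2, u $ 1]) \<bullet> y}"
    by (auto simp: cross2_def inner_vec_def sum_2 vector_2 algebra_simps)
  then show ?thesis by (metis convex_halfspace_gt)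
qed

text \<open>Being affine in t, it makes parallel projection between edges affine in the parameters.
  Restricting t to 0 \<le> t < 1 names no point twice (\<open>pt_unique\<close>).\<close>

definition pt :: "(real^2) list \<Rightarrow> nat \<Rightarrow> real \<Rightarrow> real^2" where
  "pt vs i t = vtx vs i + t *\<^sub>R edge_vec vs i"

lemma pt_0: "pt vs i 0 = vtx vs i" and pt_1: "pt vs i 1 = vtx vs (Suc i)"
  by (simp_all add: pt_def edge_vec_def)

lemma pt_diff: "pt vs i t - pt vs i s = (t - s) *\<^sub>R edge_vec vs i"
  by (simp add: pt_def algebra_simps)

text \<open>The relation \<open>hits\<close> with a fixed direction in place of the tangent line at
  y. Unlike \<open>hits\<close> it is symmetric in the two points, which allows the billiard to run
  backwards; with an edge vector for u it also describes one step of \<open>V_step\<close>.\<close>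

definition chord :: "(real^2) list \<Rightarrow> real^2 \<Rightarrow> real^2 \<Rightarrow> real^2 \<Rightarrow> bool" where
  "chord vs u x z \<longleftrightarrow> x \<in> poly_set vs \<and> z \<in> poly_set vs \<and> x \<noteq> z \<and> z - x \<in> span {u} \<and>
     open_segment x z \<subseteq> poly_int vs"

lemma chord_sym: "chord vs u x z \<longleftrightarrow> chord vs u z x"
proof -
  have "x - z \<in> span {u} \<longleftrightarrow> z - x \<in> span {u}"
    by (metis minus_diff_eq span_neg)
  then show ?thesis unfolding chord_def open_segment_commute[of x z] by blast
qed

section \<open>Existence and uniqueness of chords from nonvertex points\<close>

context polygon
begin

lemma pt_inj: "i < n \<Longrightarrow> pt vs i s = pt vs i t \<longleftrightarrow> s = t"
  using edge_vec_nz by (simp add: pt_def)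

lemma mem_cedge: "x \<in> cedge i \<longleftrightarrow> (\<exists>t. 0 \<le> t \<and> t \<le> 1 \<and> x = pt vs i t)"
  by (auto simp: closed_segment_def pt_def edge_vec_def algebra_simps)

lemma mem_edge: "i < n \<Longrightarrow> x \<in> edge vs i \<longleftrightarrow> (\<exists>t. 0 < t \<and> t < 1 \<and> x = pt vs i t)"
  using vtx_Suc_neq[of i] by (simp add: edge_def in_segment pt_def edge_vec_def algebra_simps)

lemma edge_subset_poly_set: "i < n \<Longrightarrow> edge vs i \<subseteq> poly_set vs"
  unfolding poly_set_def using cedge_eq[of i] by auto

lemma pt_in_poly_set: "i < n \<Longrightarrow> 0 \<le> t \<Longrightarrow> t \<le> 1 \<Longrightarrow> pt vs i t \<in> poly_set vs"
  unfolding poly_set_def using mem_cedge[of _ i] by blast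

lemma poly_set_nonvertex:
  assumes "x \<in> poly_set vs" "x \<notin> set vs"
  obtains i t where "i < n" "0 < t" "t < 1" "x = pt vs i t"
proof -
  from assms obtain i where i: "i < n" "x \<in> cedge i" by (auto simp: poly_set_def)
  then have "x \<in> edge vs i" using assms(2) vtx_in unfolding cedge_eq by blast
  then show ?thesis using that i mem_edge by blast
qed

lemma pt_unique:
  assumes "pt vs i s = pt vs j t" "i < n" "j < n" "0 \<le> s" "s < 1" "0 \<le> t" "t < 1"
  shows "i = j \<and> s = t"
proof -
  consider "s = 0" "t = 0" | "0 < s" "0 < t" | "s = 0" "0 < t" | "0 < s" "t = 0"
    using assms by linarith
  then have "i = j"
  proof cases
    case 1 then show ?thesis using assms by (simp add: pt_0 vtx_eq_iff)
  next
    case 2 then show ?thesis using assms edges_disjoint mem_edge by metis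
  next
    case 3 then show ?thesis using assms vtx_notin_edge[OF _ vtx_in, of j i] by (metis mem_edge pt_0)
  next
    case 4 then show ?thesis using assms vtx_notin_edge[OF _ vtx_in, of i j] by (metis mem_edge pt_0)
  qed
  then show ?thesis using assms pt_inj by auto
qed

lemma tangent_line_eq: "i < n \<Longrightarrow> x \<in> edge vs i \<Longrightarrow> tangent_line vs x = span {edge_vec vs i}"
  unfolding tangent_line_def using edges_disjoint by blast

lemma connected_in_poly_int:
  assumes "connected C" "C \<inter> poly_set vs = {}" "C \<inter> poly_int vs \<noteq> {}"
  shows "C \<subseteq> poly_int vs"
proof -
  have "C \<subseteq> poly_int vs \<union> outside (poly_set vs)"
    using assms(2) inside_Un_outside[of "poly_set vs"] by (auto simp: poly_int_def)
  moreover have "open (outside (poly_set vs))"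
    using closed_poly_set by (rule open_outside)
  ultimately have "C \<inter> outside (poly_set vs) = {}"
    using connectedD[OF assms(1) open_poly_int, of "outside (poly_set vs)"] assms(3)
      inside_Int_outside[of "poly_set vs"] unfolding poly_int_def by blast
  then show ?thesis using \<open>C \<subseteq> _\<close> by blast
qed

lemma poly_set_near_edge:
  assumes "i < n" "x \<in> edge vs i"
  obtains e where "e > 0"
    "\<And>y. dist x y < e \<Longrightarrow> y \<in> poly_set vs \<longleftrightarrow> cross2 (edge_vec vs i) (y - x) = 0"
proof -
  let ?d = "edge_vec vs i"
  define C where "C = (\<Union>j\<in>{..<n}-{i}. cedge j)"
  have "closed C" unfolding C_def by (intro closed_UN) auto
  moreover have "x \<notin> C"
  proof
    assume "x \<in> C"
    then obtain j where j: "j < n" "j \<noteq> i" "x \<in> cedge j" by (auto simp: C_def)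
    then have "x \<in> {vtx vs i, vtx vs (Suc i)}"
      using cedge_Int[of i j] assms cedge_eq[of i] by blast
    then show False using assms vtx_notin_edge vtx_in by blast
  qed
  ultimately obtain e1 where e1: "e1 > 0" "ball x e1 \<subseteq> - C"
    using open_contains_ball[of "- C"] by auto
  obtain t where t: "0 < t" "t < 1" "x = pt vs i t" using assms mem_edge by blast
  \<comment> \<open>The second bound is the distance from x to the nearer end of its edge; the first
    keeps all other edges away.\<close>
  define e where "e = min e1 (min t (1 - t) * norm ?d)"
  have nz: "norm ?d > 0" using edge_vec_nz assms by simp
  have "e > 0" using e1 t nz by (auto simp: e_def)
  moreover have "y \<in> poly_set vs \<longleftrightarrow> cross2 ?d (y - x) = 0" if y: "dist x y < e" for y
  proof
    assume "y \<in> poly_set vs"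
    then obtain j where j: "j < n" "y \<in> cedge j" by (auto simp: poly_set_def)
    moreover have "y \<notin> C" using y e1 by (auto simp: e_def)
    ultimately have "y \<in> cedge i" by (auto simp: C_def)
    then obtain s where "y = pt vs i s" using mem_cedge by blast
    then show "cross2 ?d (y - x) = 0" by (simp add: t pt_diff cross2_simps)
  next
    assume "cross2 ?d (y - x) = 0"
    then obtain c where c: "y - x = c *\<^sub>R ?d"
      using cross2_eq_0_iff[OF edge_vec_nz[OF assms(1)]] by (auto simp: span_singleton)
    then have "y = pt vs i (t + c)" using t by (simp add: pt_def algebra_simps)
    moreover have "\<bar>c\<bar> * norm ?d < min t (1 - t) * norm ?d"
      using y c by (simp add: e_def dist_norm norm_minus_commute[of x])
    then have "\<bar>c\<bar> < min t (1 - t)" using nz by simp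
    ultimately show "y \<in> poly_set vs" using assms pt_in_poly_set[of i "t + c"] by auto
  qed
  ultimately show ?thesis using that by blast
qed

text \<open>Both the inside and the outside accumulate at every point of an edge, so exactly one of the
  two half discs cut out by the edge is inside.\<close>

lemma edge_side:
  assumes "i < n" "x \<in> edge vs i"
  obtains c e where "e > 0" "c \<noteq> 0"
    "\<And>y. dist x y < e \<Longrightarrow> y \<in> poly_int vs \<longleftrightarrow> 0 < c * cross2 (edge_vec vs i) (y - x)"
proof -
  let ?d = "edge_vec vs i"
  obtain e where e: "e > 0"
    "\<And>y. dist x y < e \<Longrightarrow> y \<in> poly_set vs \<longleftrightarrow> cross2 ?d (y - x) = 0"
    using poly_set_near_edge[OF assms] by blast
  define H where "H c = ball x e \<inter> {y. 0 < c * cross2 ?d (y - x)}" for c :: real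
  have H: "H c \<subseteq> poly_int vs" if "H c \<inter> poly_int vs \<noteq> {}" for c
  proof (rule connected_in_poly_int[OF _ _ that])
    show "connected (H c)" unfolding H_def
      by (intro convex_connected convex_Int convex_ball convex_cross2_pos)
    show "H c \<inter> poly_set vs = {}" using e(2) by (auto simp: H_def)
  qed
  have x: "x \<in> poly_set vs" using assms edge_subset_poly_set by blast
  have "x \<in> closure (poly_int vs)" "x \<in> closure (outside (poly_set vs))"
    using x frontier_poly_int frontier_outside by (auto simp: frontier_def)
  then obtain y z where y: "y \<in> poly_int vs" "dist x y < e" and z: "z \<in> outside (poly_set vs)" "dist x z < e"
    using e(1) by (metis closure_approachable dist_commute)
  have "y \<notin> poly_set vs" using y poly_int_disjoint by blast
  then have "cross2 ?d (y - x) \<noteq> 0" using e y by blast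
  \<comment> \<open>The sign c marks the half disc of the inside point y. The outside point z must
    then lie in the opposite half, which therefore contains no inside point.\<close>
  define c where "c = sgn (cross2 ?d (y - x))"
  have "c \<noteq> 0" using \<open>cross2 ?d (y - x) \<noteq> 0\<close> by (simp add: c_def sgn_eq_0_iff)
  have "y \<in> H c" using y \<open>cross2 ?d (y - x) \<noteq> 0\<close> by (simp add: H_def c_def sgn_if)
  then have 1: "H c \<subseteq> poly_int vs" using H y by blast
  have zz: "z \<notin> poly_set vs" "z \<notin> poly_int vs"
    using z by (auto simp: poly_int_def outside_inside)
  then have "z \<notin> H c" using 1 by blast
  then have "z \<in> H (- c)" using z zz e(2) \<open>c \<noteq> 0\<close>
    by (auto simp: H_def not_less mult_le_0_iff zero_less_mult_iff mult_less_0_iff)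
  then have 2: "H (- c) \<inter> poly_int vs = {}" using H zz by blast
  have "y \<in> poly_int vs \<longleftrightarrow> 0 < c * cross2 ?d (y - x)" if y: "dist x y < e" for y
  proof
    assume yi: "y \<in> poly_int vs"
    then have "c * cross2 ?d (y - x) \<noteq> 0" "y \<notin> H (- c)" using e y poly_int_disjoint 2 \<open>c \<noteq> 0\<close> by auto
    moreover from this y have "\<not> c * cross2 ?d (y - x) < 0" by (simp add: H_def)
    ultimately show "0 < c * cross2 ?d (y - x)" by linarith
  next
    assume "0 < c * cross2 ?d (y - x)"
    then show "y \<in> poly_int vs" using 1 y by (auto simp: H_def)
  qed
  then show ?thesis using that e(1) \<open>c \<noteq> 0\<close> by blast
qed

text \<open>A point of the chord close to x is inside, so the hypothesis on the disc fixes the sign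
  of t. In the applications d is the edge vector at x and c, e come from
  \<open>edge_side\<close>.\<close>

lemma chord_side:
  assumes "chord vs u x (x + t *\<^sub>R u)" "e > 0"
    "\<And>y. dist x y < e \<Longrightarrow> y \<in> poly_int vs \<longleftrightarrow> 0 < c * cross2 d (y - x)"
  shows "0 < c * (t * cross2 d u)"
proof -
  let ?w = "t *\<^sub>R u"
  have w: "?w \<noteq> 0" "open_segment x (x + ?w) \<subseteq> poly_int vs" using assms by (auto simp: chord_def)
  define r where "r = min (1/2) (e / (2 * norm ?w))"
  have r: "0 < r" "r < 1" "r * norm ?w < e"
  proof -
    show "0 < r" using assms w by (auto simp: r_def)
    show "r < 1" by (auto simp: r_def)
    have "r * norm ?w \<le> e / (2 * norm ?w) * norm ?w"
      by (intro mult_right_mono) (auto simp: r_def)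
    also have "\<dots> < e" using w assms by (auto simp: divide_simps)
    finally show "r * norm ?w < e" .
  qed
  have "x + r *\<^sub>R ?w \<in> open_segment x (x + ?w)"
    using r w by (auto simp: in_segment algebra_simps intro!: exI[of _ r])
  then have "0 < c * cross2 d (r *\<^sub>R ?w)"
    using assms(3)[of "x + r *\<^sub>R ?w"] r w(2) by (auto simp: dist_norm abs_mult)
  then show ?thesis using r
    by (simp add: cross2_simps zero_less_mult_iff mult_less_0_iff)
qed

lemma chordE:
  assumes "chord vs u x z"
  obtains t where "z = x + t *\<^sub>R u" "t \<noteq> 0"
proof -
  obtain t where t: "z - x = t *\<^sub>R u" "x \<noteq> z" using assms by (auto simp: chord_def span_singleton)
  then show ?thesis using that[of t] by (auto simp: algebra_simps)
qed

lemma chord_transversal: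
  assumes "chord vs u x z" "i < n" "x \<in> edge vs i"
  shows "cross2 (edge_vec vs i) u \<noteq> 0"
proof -
  obtain t where "z = x + t *\<^sub>R u" using assms chordE by blast
  moreover obtain c e where "e > 0"
    "\<And>y. dist x y < e \<Longrightarrow> y \<in> poly_int vs \<longleftrightarrow> 0 < c * cross2 (edge_vec vs i) (y - x)"
    using edge_side[OF assms(2,3)] by metis
  ultimately show ?thesis using chord_side assms(1) by fastforce
qed

text \<open>By \<open>chord_side\<close> both chords leave x on the same ray. If their ends
  differed, the nearer end, a point of the polygon, would lie in the open segment of the longer
  chord.\<close>

lemma chord_unique:
  assumes "chord vs u x z" "chord vs u x w" "i < n" "x \<in> edge vs i"
  shows "z = w"
proof -
  have *: "s = t" if c: "chord vs u x (x + s *\<^sub>R u)" "chord vs u x (x + t *\<^sub>R u)" and "s * t > 0" "\<bar>s\<bar> \<le> \<bar>t\<bar>" for s t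
  proof (rule ccontr)
    assume "s \<noteq> t"
    define q where "q = s / t"
    have q: "0 < q" "q < 1" "s = q * t"
      using that \<open>s \<noteq> t\<close> by (auto simp: q_def divide_simps zero_less_mult_iff abs_if split: if_splits)
    have "x + s *\<^sub>R u \<in> open_segment x (x + t *\<^sub>R u)"
      using q c by (auto simp: in_segment chord_def algebra_simps intro!: exI[of _ q])
    then show False using c poly_int_disjoint by (auto simp: chord_def)
  qed
  obtain s where s: "z = x + s *\<^sub>R u" using assms chordE by blast
  obtain t where t: "w = x + t *\<^sub>R u" using assms chordE by blast
  obtain c e where ce: "e > 0"
    "\<And>y. dist x y < e \<Longrightarrow> y \<in> poly_int vs \<longleftrightarrow> 0 < c * cross2 (edge_vec vs i) (y - x)"
    using edge_side[OF assms(3,4)] by metis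
  have "0 < c * (s * cross2 (edge_vec vs i) u)" "0 < c * (t * cross2 (edge_vec vs i) u)"
    using chord_side[OF _ ce] assms s t by auto
  then have "s * t > 0" by (auto simp: zero_less_mult_iff mult_less_0_iff)
  then have "s = t" using *[of s t] *[of t s] assms s t by (cases "\<bar>s\<bar> \<le> \<bar>t\<bar>") (auto simp: mult.commute)
  then show ?thesis using s t by simp
qed

text \<open>Since u crosses the edge, u or its negative points to the inner side; the inside is
  bounded, so the ray must leave it, and the first exit is z.\<close>

lemma chord_exists:
  assumes "i < n" "x \<in> edge vs i" "cross2 (edge_vec vs i) u \<noteq> 0"
  obtains z where "chord vs u x z"
proof -
  let ?d = "edge_vec vs i"
  obtain c e where ce: "e > 0" "c \<noteq> 0"
    "\<And>y. dist x y < e \<Longrightarrow> y \<in> poly_int vs \<longleftrightarrow> 0 < c * cross2 ?d (y - x)"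
    using edge_side[OF assms(1,2)] by metis
  define \<sigma> where "\<sigma> = sgn (c * cross2 ?d u)"
  define w where "w = \<sigma> *\<^sub>R u"
  have "c * cross2 ?d u \<noteq> 0" using ce assms by simp
  then have cw: "0 < c * cross2 ?d w"
    by (simp add: w_def \<sigma>_def cross2_simps mult.left_commute[of c] flip: abs_sgn)
      (simp add: mult.commute flip: abs_sgn)
  have "w \<noteq> 0" using cw by (auto simp: cross2_def)
  define s where "s = e / (2 * norm w)"
  have s: "0 < s" "s * norm w < e" using ce \<open>w \<noteq> 0\<close> by (auto simp: s_def divide_simps)
  have near: "x + r *\<^sub>R w \<in> poly_int vs" if "0 < r" "r \<le> s" for r
  proof -
    have "r * norm w \<le> s * norm w" using that by (simp add: mult_right_mono)
    then have "dist x (x + r *\<^sub>R w) < e" using s that by (simp add: dist_norm)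
    moreover have "0 < c * cross2 ?d (r *\<^sub>R w)"
      using cw that by (simp add: cross2_simps mult.left_commute[of c])
    ultimately show ?thesis using ce(3) by simp
  qed
  \<comment> \<open>The ray is started at \<open>x + s *\<^sub>R w\<close>, since x itself lies on
    the boundary; \<open>near\<close> covers the initial piece.\<close>
  obtain D where D: "0 < D" "x + s *\<^sub>R w + D *\<^sub>R w \<in> frontier (poly_int vs)"
    "\<And>E. 0 \<le> E \<Longrightarrow> E < D \<Longrightarrow> x + s *\<^sub>R w + E *\<^sub>R w \<in> interior (poly_int vs)"
    using ray_to_frontier[OF bounded_poly_int, of "x + s *\<^sub>R w" w] near[of s] s \<open>w \<noteq> 0\<close>
      interior_open[OF open_poly_int] by auto
  define z where "z = x + (s + D) *\<^sub>R w"
  have "chord vs u x z"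
    unfolding chord_def
  proof (intro conjI subsetI)
    show "x \<in> poly_set vs" using assms edge_subset_poly_set by blast
    show "z \<in> poly_set vs" using D(2) by (simp add: z_def frontier_poly_int algebra_simps)
    show "x \<noteq> z" using \<open>w \<noteq> 0\<close> s D by (simp add: z_def)
    show "z - x \<in> span {u}" by (auto simp: z_def w_def span_singleton)
    fix y assume "y \<in> open_segment x z"
    then obtain q where q: "0 < q" "q < 1" "y = x + (q * (s + D)) *\<^sub>R w"
      by (auto simp: in_segment z_def algebra_simps)
    show "y \<in> poly_int vs"
    proof (cases "q * (s + D) \<le> s")
      case True then show ?thesis using near q s D by simp
    next
      case False
      have "q * (s + D) < s + D" using q s D by simp
      then have "x + s *\<^sub>R w + (q * (s + D) - s) *\<^sub>R w \<in> interior (poly_int vs)"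
        using False by (intro D(3)) auto
      then show ?thesis using q interior_open[OF open_poly_int] by (simp add: algebra_simps)
    qed
  qed
  then show ?thesis using that by blast
qed

end

section \<open>Affine and continuous maps between intervals\<close>

lemma affine_image_greaterThanLessThan:
  fixes \<alpha> \<beta> a b :: real
  assumes "\<alpha> \<noteq> 0"
  shows "(\<lambda>t. \<alpha> * t + \<beta>) ` {a<..<b} =
    (if 0 < \<alpha> then {\<alpha> * a + \<beta><..<\<alpha> * b + \<beta>} else {\<alpha> * b + \<beta><..<\<alpha> * a + \<beta>})" (is "?L = ?R")
proof
  show "?L \<subseteq> ?R"
    using assms by (auto simp: mult_strict_left_mono mult_strict_left_mono_neg)
  show "?R \<subseteq> ?L"
  proof
    fix s assume s: "s \<in> ?R"
    have "s = \<alpha> * ((s - \<beta>) / \<alpha>) + \<beta>" using assms by simp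
    moreover have "(s - \<beta>) / \<alpha> \<in> {a<..<b}"
      using s assms by (auto simp: field_simps split: if_splits)
    ultimately show "s \<in> ?L" by blast
  qed
qed

lemma affine_interval_endpoints:
  fixes \<alpha> \<beta> a b a' b' :: real
  assumes "\<alpha> \<noteq> 0" "a < b" "a' < b'" "(\<lambda>t. \<alpha> * t + \<beta>) ` {a<..<b} = {a'<..<b'}"
  shows "(a' = \<alpha> * a + \<beta> \<and> b' = \<alpha> * b + \<beta>) \<or> (a' = \<alpha> * b + \<beta> \<and> b' = \<alpha> * a + \<beta>)"
  using assms(4) affine_image_greaterThanLessThan[OF assms(1), of \<beta> a b] assms(1-3)
  by (auto simp: greaterThanLessThan_eq_iff split: if_splits)

lemma continuous_image_avoids_endpoints:
  fixes f :: "real \<Rightarrow> real"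
  assumes "continuous_on {a<..<b} f" "t \<in> {a<..<b}" "f t \<in> {a'<..<b'}"
    "\<And>t. t \<in> {a<..<b} \<Longrightarrow> f t \<noteq> a' \<and> f t \<noteq> b'"
  shows "f ` {a<..<b} \<subseteq> {a'<..<b'}"
proof (rule ccontr)
  assume "\<not> f ` {a<..<b} \<subseteq> {a'<..<b'}"
  then obtain r where r: "r \<in> {a<..<b}" "f r \<notin> {a'<..<b'}" by blast
  have "connected (f ` {a<..<b})"
    using assms(1) by (intro connected_continuous_image) auto
  then have "is_interval (f ` {a<..<b})" by (simp add: is_interval_connected_1)
  then have *: "y \<in> f ` {a<..<b}" if "f r \<le> y \<and> y \<le> f t \<or> f t \<le> y \<and> y \<le> f r" for y
    using that r assms(2) unfolding is_interval_1 by (meson image_eqI)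
  have "a' \<in> f ` {a<..<b} \<or> b' \<in> f ` {a<..<b}"
    using *[of a'] *[of b'] r assms(3) by (auto simp: not_less)
  then show False using assms(4) by blast
qed

context polygon
begin

text \<open>Parallelism to u is the vanishing of a determinant that is affine in s and t, and both
  coefficients are nonzero because neither edge is parallel to u.\<close>

lemma projection_affine:
  assumes "cross2 (edge_vec vs i) u \<noteq> 0" "cross2 (edge_vec vs k) u \<noteq> 0"
  obtains \<alpha> \<beta> where "\<alpha> \<noteq> 0" "\<And>t s. pt vs k s - pt vs i t \<in> span {u} \<longleftrightarrow> s = \<alpha> * t + \<beta>"
proof -
  have u: "u \<noteq> 0" using assms by (auto simp: cross2_def)
  define \<alpha> \<beta> where "\<alpha> = cross2 u (edge_vec vs i) / cross2 u (edge_vec vs k)"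
    and "\<beta> = cross2 u (vtx vs i - vtx vs k) / cross2 u (edge_vec vs k)"
  have nz: "cross2 u (edge_vec vs i) \<noteq> 0" "cross2 u (edge_vec vs k) \<noteq> 0"
    using assms cross2_commute[of u] by auto
  have "pt vs k s - pt vs i t \<in> span {u} \<longleftrightarrow> s = \<alpha> * t + \<beta>" for t s
  proof -
    have "pt vs k s - pt vs i t \<in> span {u} \<longleftrightarrow> cross2 u (pt vs k s - pt vs i t) = 0"
      using cross2_eq_0_iff[OF u] by simp
    also have "\<dots> \<longleftrightarrow> s = \<alpha> * t + \<beta>"
      using nz by (auto simp: pt_def cross2_simps \<alpha>_def \<beta>_def field_simps)
    finally show ?thesis .
  qed
  moreover have "\<alpha> \<noteq> 0" using nz by (simp add: \<alpha>_def)
  ultimately show ?thesis using that by blast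
qed

text \<open>The far end is kept off the vertices as well; this is what makes the set open.\<close>

definition chord_params :: "real^2 \<Rightarrow> nat \<Rightarrow> nat \<Rightarrow> real set" where
  "chord_params u i k =
     {t. 0 < t \<and> t < 1 \<and> (\<exists>s. 0 < s \<and> s < 1 \<and> chord vs u (pt vs i t) (pt vs k s))}"

lemma chord_edges_transversal:
  assumes "chord vs u (pt vs i t) (pt vs k s)" "i < n" "k < n" "0 < t" "t < 1" "0 < s" "s < 1"
  shows "cross2 (edge_vec vs i) u \<noteq> 0" "cross2 (edge_vec vs k) u \<noteq> 0"
  using chord_transversal assms mem_edge chord_sym by metis+

text \<open>Otherwise u would be parallel to the edge, against transversality.\<close>

lemma chord_edges_distinct:
  assumes "chord vs u (pt vs i t) (pt vs k s)" "i < n" "k < n" "0 < t" "t < 1" "0 < s" "s < 1"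
  shows "i \<noteq> k"
proof
  assume "i = k"
  obtain c where c: "pt vs k s = pt vs i t + c *\<^sub>R u" "c \<noteq> 0"
    using chordE assms(1) by metis
  then have "c *\<^sub>R u = (s - t) *\<^sub>R edge_vec vs i"
    using \<open>i = k\<close> pt_diff[of vs i s t] by (simp add: algebra_simps)
  then have "c * cross2 (edge_vec vs i) u = 0"
    by (metis cross2_scaleR_right cross2_self mult_zero_right)
  then show False using c chord_edges_transversal(1)[OF assms] by simp
qed

text \<open>A chord is disjoint from the edges other than those of its endpoints, and this persists for
  nearby parallel segments by compactness.\<close>

lemma open_chord_params:
  assumes "i < n" "k < n"
  shows "open (chord_params u i k)"
proof (subst open_subopen, intro ballI)
  fix t0 assume "t0 \<in> chord_params u i k"
  then obtain s0 where t0: "0 < t0" "t0 < 1" and s0: "0 < s0" "s0 < 1"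
    and ch: "chord vs u (pt vs i t0) (pt vs k s0)" by (auto simp: chord_params_def)
  note tr = chord_edges_transversal[OF ch assms t0 s0]
  have ik: "i \<noteq> k" using chord_edges_distinct[OF ch assms t0 s0] .
  obtain \<alpha> \<beta> where A: "\<And>t s. pt vs k s - pt vs i t \<in> span {u} \<longleftrightarrow> s = \<alpha> * t + \<beta>"
    using projection_affine[OF tr] by metis
  \<comment> \<open>For fixed t this runs through the segment from the point t of edge i to its
    projection along u on the line of edge k.\<close>
  define g where "g = (\<lambda>(t, q). pt vs i t + q *\<^sub>R (pt vs k (\<alpha> * t + \<beta>) - pt vs i t))"
  have gcont: "continuous_on S g" for S
    unfolding g_def case_prod_beta pt_def by (intro continuous_intros)
  have s0A: "s0 = \<alpha> * t0 + \<beta>" using A ch by (simp add: chord_def)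
  \<comment> \<open>The parameters whose segment meets edge j. As the projection of a compact set it
    is closed.\<close>
  define Q where "Q j = fst ` (({0..1} \<times> {0..1}) \<inter> g -` cedge j)" for j
  have Qc: "closed (Q j)" for j
  proof -
    have "compact (({0..1} \<times> {0..1}) \<inter> g -` cedge j)"
      by (intro compact_Int_closed compact_Times closed_vimage gcont) auto
    then show ?thesis unfolding Q_def
      by (intro compact_imp_closed compact_continuous_image continuous_on_fst continuous_on_id)
  qed
  \<comment> \<open>Once the open segment misses the polygon, connectedness lets its midpoint decide
    whether all of it is inside.\<close>
  define U where "U = {0<..<1} \<inter> (\<lambda>t. \<alpha> * t + \<beta>) -` {0<..<1} \<inter> (\<Inter>j\<in>{..<n} - {i, k}. - Q j)
    \<inter> (\<lambda>t. g (t, 1/2)) -` poly_int vs"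
  have "open U" unfolding U_def
  proof (intro open_Int open_INT ballI)
    show "open ((\<lambda>t. \<alpha> * t + \<beta>) -` {0<..<1})"
      by (intro open_vimage continuous_intros open_greaterThanLessThan)
    show "open ((\<lambda>t. g (t, 1/2)) -` poly_int vs)"
      by (intro open_vimage open_poly_int) (auto simp: g_def pt_def intro!: continuous_intros)
  qed (use Qc in auto)
  moreover have "t0 \<in> U"
  proof -
    have "t0 \<notin> Q j" if j: "j < n" "j \<noteq> i" "j \<noteq> k" for j
    proof
      assume "t0 \<in> Q j"
      then obtain q where q: "0 \<le> q" "q \<le> 1" "g (t0, q) \<in> cedge j" by (auto simp: Q_def)
      have e: "pt vs i t0 \<in> edge vs i" "pt vs k s0 \<in> edge vs k"
        using assms t0 s0 mem_edge by blast+
      have "x \<notin> cedge j" if "x \<in> edge vs l" "l < n" "l \<noteq> j" for x l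
        using cedge_Int[of l j] that j cedge_eq[of l] vtx_notin_edge vtx_in by blast
      then have "q \<noteq> 0" "q \<noteq> 1"
        using q(3) e j assms by (auto simp: g_def s0A)
      then have "g (t0, q) \<in> open_segment (pt vs i t0) (pt vs k s0)"
        using q ch by (auto simp: g_def s0A in_segment chord_def algebra_simps intro!: exI[of _ q])
      then have "g (t0, q) \<in> poly_int vs" using ch by (auto simp: chord_def)
      moreover have "g (t0, q) \<in> poly_set vs" using q j by (auto simp: poly_set_def)
      ultimately show False using poly_int_disjoint by blast
    qed
    moreover have "g (t0, 1/2) \<in> open_segment (pt vs i t0) (pt vs k s0)"
      using ch by (auto simp: g_def s0A in_segment chord_def algebra_simps intro!: exI[of _ "1/2"])
    then have "g (t0, 1/2) \<in> poly_int vs" using ch by (auto simp: chord_def)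
    ultimately show ?thesis using t0 s0 by (auto simp: U_def s0A)
  qed
  moreover have "U \<subseteq> chord_params u i k"
  proof
    fix t assume tU: "t \<in> U"
    define s where "s = \<alpha> * t + \<beta>"
    have t: "0 < t" "t < 1" and s: "0 < s" "s < 1" and nQ: "\<And>j. j < n \<Longrightarrow> j \<noteq> i \<Longrightarrow> j \<noteq> k \<Longrightarrow> t \<notin> Q j"
      and mid: "g (t, 1/2) \<in> poly_int vs"
      using tU by (auto simp: U_def s_def)
    let ?x = "pt vs i t" and ?z = "pt vs k s"
    have xz: "?x \<noteq> ?z" using pt_unique assms t s ik by (metis less_imp_le)
    have sp: "?z - ?x \<in> span {u}" using A s_def by simp
    obtain c where c: "?z - ?x = c *\<^sub>R u" using sp by (auto simp: span_singleton)
    have c0: "c \<noteq> 0" using c xz by auto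
    have "open_segment ?x ?z \<subseteq> poly_int vs"
    proof (rule connected_in_poly_int)
      show "connected (open_segment ?x ?z)" by (simp add: convex_connected)
      have "g (t, 1/2) \<in> open_segment ?x ?z"
        using xz by (auto simp: g_def s_def in_segment algebra_simps intro!: exI[of _ "1/2"])
      then show "open_segment ?x ?z \<inter> poly_int vs \<noteq> {}" using mid by blast
      have False if y: "y \<in> open_segment ?x ?z" "y \<in> poly_set vs" for y
      proof -
        obtain q where q: "0 < q" "q < 1" "y = ?x + q *\<^sub>R (?z - ?x)"
          using y by (auto simp: in_segment algebra_simps)
        obtain j where j: "j < n" "y \<in> cedge j" using y by (auto simp: poly_set_def)
        have "y = g (t, q)" using q by (simp add: g_def s_def)
        moreover from this have "t \<in> Q j"
          unfolding Q_def using q t j by (intro image_eqI[of _ _ "(t, q)"]) auto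
        ultimately have "j = i \<or> j = k" using nQ[of j] j by blast
        moreover obtain r where "y = pt vs j r" using j mem_cedge by blast
        moreover have "y - ?x = (q * c) *\<^sub>R u" "y - ?z = ((q - 1) * c) *\<^sub>R u"
          using q c by (auto simp: algebra_simps)
        \<comment> \<open>A further point of the segment on the line of one of its end edges would
          make u parallel to that edge.\<close>
        ultimately have "(q * c) *\<^sub>R u = (r - t) *\<^sub>R edge_vec vs i \<or> ((q - 1) * c) *\<^sub>R u = (r - s) *\<^sub>R edge_vec vs k"
          using pt_diff by metis
        then have "q * c * cross2 (edge_vec vs i) u = 0 \<or> (q - 1) * c * cross2 (edge_vec vs k) u = 0"
          by (metis cross2_scaleR_right cross2_self mult_zero_right)
        then show False using q c0 tr by auto
      qed
      then show "open_segment ?x ?z \<inter> poly_set vs = {}" by blast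
    qed
    then have "chord vs u ?x ?z"
      unfolding chord_def using sp xz pt_in_poly_set assms t s by simp
    then show "t \<in> chord_params u i k" using t s by (auto simp: chord_params_def)
  qed
  ultimately show "\<exists>T. open T \<and> t0 \<in> T \<and> T \<subseteq> chord_params u i k" by blast
qed

end

section \<open>The end edge along an interval without filled points\<close>

text \<open>A billiard step uses a single direction u. \<open>filled_part\<close> is closed under
  chords in every edge direction of the other polygon, so it fits this locale for each of
  them.\<close>

locale filled_polygon = polygon +
  fixes F :: "(real^2) set" and u :: "real^2"
  assumes finite_F: "finite F" and vertices_F: "set vs \<subseteq> F"
    and chord_F: "\<And>x z. chord vs u x z \<Longrightarrow> x \<in> F \<Longrightarrow> z \<in> F"
begin

lemma chord_F_iff: "chord vs u x z \<Longrightarrow> x \<in> F \<longleftrightarrow> z \<in> F"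
  using chord_F chord_sym by blast

text \<open>Along an interval without points of \<open>F\<close> no chord ends in a vertex, so the open sets
  \<open>chord_params u i l\<close> partition the interval, and by connectedness only one of them is nonempty.\<close>

lemma chord_params_interval:
  assumes "i < n" "k < n" "0 \<le> a" "b \<le> 1"
    and noF: "\<And>t. t \<in> {a<..<b} \<Longrightarrow> pt vs i t \<notin> F"
    and t0: "t0 \<in> {a<..<b}" "t0 \<in> chord_params u i k"
  shows "{a<..<b} \<subseteq> chord_params u i k"
proof -
  define R where "R = (\<Union>l\<in>{..<n} - {k}. chord_params u i l)"
  have oR: "open R" unfolding R_def using assms(1) open_chord_params by blast
  have tr: "cross2 (edge_vec vs i) u \<noteq> 0"
    using t0 assms chord_edges_transversal(1) by (auto simp: chord_params_def)
  have cover: "{a<..<b} \<subseteq> chord_params u i k \<union> R"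
  proof
    fix t assume t: "t \<in> {a<..<b}"
    then have t01: "0 < t" "t < 1" using assms by auto
    then obtain z where z: "chord vs u (pt vs i t) z"
      using chord_exists[OF assms(1) _ tr] mem_edge[OF assms(1)] by metis
    then have "z \<notin> F" using noF t chord_F_iff by blast
    then have "z \<notin> set vs" "z \<in> poly_set vs" using vertices_F z by (auto simp: chord_def)
    then obtain l s where "l < n" "0 < s" "s < 1" "z = pt vs l s" using poly_set_nonvertex by metis
    then have "t \<in> chord_params u i l" "l < n" using z t01 by (auto simp: chord_params_def)
    then show "t \<in> chord_params u i k \<union> R" by (auto simp: R_def)
  qed
  have "chord_params u i k \<inter> R = {}"
  proof -
    have False if t: "t \<in> chord_params u i k" "t \<in> chord_params u i l" "l < n" "l \<noteq> k" for t l
    proof -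
      obtain s r where sr: "0 < t" "t < 1" "0 < s" "s < 1" "0 < r" "r < 1"
        "chord vs u (pt vs i t) (pt vs k s)" "chord vs u (pt vs i t) (pt vs l r)"
        using t by (auto simp: chord_params_def)
      then have "pt vs k s = pt vs l r" using chord_unique assms(1) mem_edge by metis
      then show False using pt_unique sr t assms by (metis less_imp_le)
    qed
    then show ?thesis by (auto simp: R_def)
  qed
  then have "R \<inter> {a<..<b} = {}"
    using connectedD[OF connected_Ioo[of a b] open_chord_params[OF assms(1,2)] oR _ cover] t0 by blast
  then show ?thesis using cover by blast
qed

end

section \<open>Cells\<close>

definition marks :: "(real^2) list \<Rightarrow> (real^2) set \<Rightarrow> nat \<Rightarrow> real set" where
  "marks vs F i = {t. 0 \<le> t \<and> t \<le> 1 \<and> pt vs i t \<in> F}"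

text \<open>The vertices are filled, so 0 and 1 are marks; hence for t in the unit interval both
  this maximum and the minimum below are attained.\<close>

definition lower_mark :: "(real^2) list \<Rightarrow> (real^2) set \<Rightarrow> nat \<Rightarrow> real \<Rightarrow> real" where
  "lower_mark vs F i t = Max {m \<in> marks vs F i. m \<le> t}"

definition upper_mark :: "(real^2) list \<Rightarrow> (real^2) set \<Rightarrow> nat \<Rightarrow> real \<Rightarrow> real" where
  "upper_mark vs F i t = Min {m \<in> marks vs F i. t \<le> m}"

text \<open>The cells are the points of \<open>F\<close>, where both marks coincide with the point itself, and the
  components of the edges without \<open>F\<close>.\<close>

definition same_cell ::
  "(real^2) list \<Rightarrow> (real^2) set \<Rightarrow> nat \<times> real \<Rightarrow> nat \<times> real \<Rightarrow> bool" where
  "same_cell vs F = (\<lambda>(i, t) (j, s). i = j \<and> lower_mark vs F i t = lower_mark vs F j s \<and>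
     upper_mark vs F i t = upper_mark vs F j s)"

locale marked_polygon = polygon +
  fixes F :: "(real^2) set"
  assumes finite_F: "finite F" and vertices_F: "set vs \<subseteq> F"
begin

abbreviation "lo \<equiv> lower_mark vs F"
abbreviation "up \<equiv> upper_mark vs F"

lemma finite_marks: "i < n \<Longrightarrow> finite (marks vs F i)"
proof -
  assume "i < n"
  then have "inj (pt vs i)" using pt_inj by (auto simp: inj_def)
  then have "finite (pt vs i -` F)" using finite_F by (intro finite_vimageI)
  then show ?thesis by (rule rev_finite_subset) (auto simp: marks_def)
qed

lemma zero_mark: "0 \<in> marks vs F i" and one_mark: "1 \<in> marks vs F i"
  using vertices_F vtx_in by (auto simp: marks_def pt_0 pt_1)

lemma lower_mark:
  assumes "i < n" "0 \<le> t"
  shows "lo i t \<in> marks vs F i" "lo i t \<le> t" "\<And>m. m \<in> marks vs F i \<Longrightarrow> m \<le> t \<Longrightarrow> m \<le> lo i t"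
proof -
  have f: "finite {m \<in> marks vs F i. m \<le> t}" using finite_marks assms by simp
  have "{m \<in> marks vs F i. m \<le> t} \<noteq> {}" using zero_mark assms by auto
  from Max_in[OF f this] show "lo i t \<in> marks vs F i" "lo i t \<le> t" by (auto simp: lower_mark_def)
  show "\<And>m. m \<in> marks vs F i \<Longrightarrow> m \<le> t \<Longrightarrow> m \<le> lo i t" using f by (simp add: lower_mark_def)
qed

lemma upper_mark:
  assumes "i < n" "t \<le> 1"
  shows "up i t \<in> marks vs F i" "t \<le> up i t" "\<And>m. m \<in> marks vs F i \<Longrightarrow> t \<le> m \<Longrightarrow> up i t \<le> m"
proof -
  have f: "finite {m \<in> marks vs F i. t \<le> m}" using finite_marks assms by simp
  have "{m \<in> marks vs F i. t \<le> m} \<noteq> {}" using one_mark assms by auto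
  from Min_in[OF f this] show "up i t \<in> marks vs F i" "t \<le> up i t" by (auto simp: upper_mark_def)
  show "\<And>m. m \<in> marks vs F i \<Longrightarrow> t \<le> m \<Longrightarrow> up i t \<le> m" using f by (simp add: upper_mark_def)
qed

lemma marks_at_mark:
  assumes "i < n" "t \<in> marks vs F i"
  shows "lo i t = t" "up i t = t"
  using lower_mark[of i t] upper_mark[of i t] assms
  by (auto simp: marks_def intro: antisym)

lemma marks_strict:
  assumes "i < n" "0 < t" "t < 1" "t \<notin> marks vs F i"
  shows "lo i t < t" "t < up i t" "0 \<le> lo i t" "up i t \<le> 1"
  using lower_mark[of i t] upper_mark[of i t] assms
  by (auto simp: marks_def less_le)

lemma marks_eqI:
  assumes "i < n" "a \<in> marks vs F i" "b \<in> marks vs F i" "a < t" "t < b"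
    "\<And>m. m \<in> marks vs F i \<Longrightarrow> \<not> (a < m \<and> m < b)"
  shows "lo i t = a" "up i t = b"
proof -
  have t: "0 \<le> t" "t \<le> 1" using assms by (auto simp: marks_def)
  note l = lower_mark[OF assms(1) t(1)] and r = upper_mark[OF assms(1) t(2)]
  show "lo i t = a" using l(1,2) l(3)[OF assms(2)] assms(4,5) assms(6)[OF l(1)] by linarith
  show "up i t = b" using r(1,2) r(3)[OF assms(3)] assms(4,5) assms(6)[OF r(1)] by linarith
qed

lemma no_marks_between:
  assumes "i < n" "0 < t" "t < 1" "lo i t < m" "m < up i t" "t \<notin> marks vs F i"
  shows "m \<notin> marks vs F i"
  using lower_mark(3)[of i t m] upper_mark(3)[of i t m] assms by fastforce

end

sublocale filled_polygon \<subseteq> marked_polygon vs F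
  using finite_F vertices_F by unfold_locales

section \<open>Transport of cells along chords\<close>

context filled_polygon
begin

text \<open>The far ends of chords from unfilled points are unfilled, so their parameters never
  cross a mark and by continuity stay between the same two. Only an inclusion results, but it also
  applies to the reversed chord.\<close>

lemma open_cell_into:
  assumes "i < n" "k < n" and t: "0 < t" "t < 1" and s: "0 < s" "s < 1"
    and ch: "chord vs u (pt vs i t) (pt vs k s)" and tF: "t \<notin> marks vs F i"
    and A: "\<And>t s. pt vs k s - pt vs i t \<in> span {u} \<longleftrightarrow> s = \<alpha> * t + \<beta>"
    and r: "r \<in> {lo i t<..<up i t}"
  shows "0 < \<alpha> * r + \<beta>" "\<alpha> * r + \<beta> < 1" "chord vs u (pt vs i r) (pt vs k (\<alpha> * r + \<beta>))"
    "\<alpha> * r + \<beta> \<in> {lo k s<..<up k s}"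
proof -
  note m = marks_strict[OF assms(1) t tF]
  have noF: "pt vs i r \<notin> F" if "r \<in> {lo i t<..<up i t}" for r
    using no_marks_between[OF assms(1) t _ _ tF, of r] that m by (auto simp: marks_def)
  have "{lo i t<..<up i t} \<subseteq> chord_params u i k"
    by (rule chord_params_interval[OF assms(1,2) _ _ noF, of _ _ t])
      (use m t s ch in \<open>auto simp: chord_params_def\<close>)
  then have all: "0 < \<alpha> * r + \<beta> \<and> \<alpha> * r + \<beta> < 1 \<and> chord vs u (pt vs i r) (pt vs k (\<alpha> * r + \<beta>))"
    if "r \<in> {lo i t<..<up i t}" for r
    using that A by (force simp: chord_params_def chord_def)
  then show "0 < \<alpha> * r + \<beta>" "\<alpha> * r + \<beta> < 1" "chord vs u (pt vs i r) (pt vs k (\<alpha> * r + \<beta>))"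
    using r by auto
  have sA: "s = \<alpha> * t + \<beta>" using A ch by (auto simp: chord_def)
  have sF: "s \<notin> marks vs F k" using chord_F_iff[OF ch] tF t s by (auto simp: marks_def)
  note m' = marks_strict[OF assms(2) s sF]
  have "(\<lambda>r. \<alpha> * r + \<beta>) ` {lo i t<..<up i t} \<subseteq> {lo k s<..<up k s}"
  proof (rule continuous_image_avoids_endpoints[where t = t])
    fix r assume r: "r \<in> {lo i t<..<up i t}"
    have "\<alpha> * r + \<beta> \<notin> marks vs F k"
      using all[OF r] noF[OF r] chord_F_iff by (auto simp: marks_def)
    then show "\<alpha> * r + \<beta> \<noteq> lo k s \<and> \<alpha> * r + \<beta> \<noteq> up k s"
      using lower_mark(1)[of k s] upper_mark(1)[of k s] assms(2) s by auto
  qed (use m m' sA in \<open>auto intro!: continuous_intros\<close>)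
  then show "\<alpha> * r + \<beta> \<in> {lo k s<..<up k s}" using r by blast
qed

text \<open>For a filled point the cell is that point alone. Otherwise the inclusions for the chord
  and its reversal make the projection a bijection of open intervals, so it carries ends to ends, in
  the same or the opposite order.\<close>

lemma chord_carries_cell:
  assumes "i < n" "k < n" and t: "0 < t" "t < 1" and s: "0 < s" "s < 1"
    and ch: "chord vs u (pt vs i t) (pt vs k s)"
  obtains \<alpha> \<beta> where "\<alpha> \<noteq> 0" "s = \<alpha> * t + \<beta>"
    "(lo k s = \<alpha> * lo i t + \<beta> \<and> up k s = \<alpha> * up i t + \<beta>) \<or>
     (lo k s = \<alpha> * up i t + \<beta> \<and> up k s = \<alpha> * lo i t + \<beta>)"
    "\<And>r. 0 < r \<Longrightarrow> r < 1 \<Longrightarrow> same_cell vs F (i, t) (i, r) \<Longrightarrow>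
       0 < \<alpha> * r + \<beta> \<and> \<alpha> * r + \<beta> < 1 \<and> chord vs u (pt vs i r) (pt vs k (\<alpha> * r + \<beta>)) \<and>
       same_cell vs F (k, s) (k, \<alpha> * r + \<beta>)"
proof -
  note tr = chord_edges_transversal[OF ch assms(1,2) t s]
  obtain \<alpha> \<beta> where \<alpha>: "\<alpha> \<noteq> 0" and A: "\<And>t s. pt vs k s - pt vs i t \<in> span {u} \<longleftrightarrow> s = \<alpha> * t + \<beta>"
    using projection_affine[OF tr] by metis
  have sA: "s = \<alpha> * t + \<beta>" using A ch by (auto simp: chord_def)
  show ?thesis
  proof (cases "t \<in> marks vs F i")
    case True
    then have sF: "s \<in> marks vs F k" using chord_F_iff[OF ch] t s by (auto simp: marks_def)
    note mt = marks_at_mark[OF assms(1) True] and ms = marks_at_mark[OF assms(2) sF]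
    show ?thesis
    proof (rule that[OF \<alpha> sA])
      fix r assume r: "0 < r" "r < 1" "same_cell vs F (i, t) (i, r)"
      then have "r = t"
        using lower_mark(2)[of i r] upper_mark(2)[of i r] assms(1) mt by (simp add: same_cell_def)
      then show "0 < \<alpha> * r + \<beta> \<and> \<alpha> * r + \<beta> < 1 \<and> chord vs u (pt vs i r) (pt vs k (\<alpha> * r + \<beta>)) \<and>
         same_cell vs F (k, s) (k, \<alpha> * r + \<beta>)"
        using sA s ch by (simp add: same_cell_def)
    qed (metis mt ms sA)
  next
    case False
    then have sF: "s \<notin> marks vs F k" using chord_F_iff[OF ch] t s by (auto simp: marks_def)
    note mt = marks_strict[OF assms(1) t False] and ms = marks_strict[OF assms(2) s sF]
    note fwd = open_cell_into[OF assms(1,2) t s ch False A]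
    have B: "pt vs i t - pt vs k s \<in> span {u} \<longleftrightarrow> t = (1 / \<alpha>) * s + (- \<beta> / \<alpha>)" for t s
    proof -
      have "pt vs i t - pt vs k s \<in> span {u} \<longleftrightarrow> pt vs k s - pt vs i t \<in> span {u}"
        by (metis minus_diff_eq span_neg)
      also have "\<dots> \<longleftrightarrow> t = (1 / \<alpha>) * s + (- \<beta> / \<alpha>)"
        using \<alpha> unfolding A by (auto simp: field_simps)
      finally show ?thesis .
    qed
    note bwd = open_cell_into[OF assms(2,1) s t ch[unfolded chord_sym[of _ _ "pt vs i t"]] sF B]
    have "(\<lambda>r. \<alpha> * r + \<beta>) ` {lo i t<..<up i t} = {lo k s<..<up k s}"
    proof
      show "{lo k s<..<up k s} \<subseteq> (\<lambda>r. \<alpha> * r + \<beta>) ` {lo i t<..<up i t}"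
      proof
        fix q assume q: "q \<in> {lo k s<..<up k s}"
        show "q \<in> (\<lambda>r. \<alpha> * r + \<beta>) ` {lo i t<..<up i t}"
          using bwd(4)[OF q] \<alpha> by (intro image_eqI[of _ _ "(1 / \<alpha>) * q + (- \<beta> / \<alpha>)"]) (auto simp: field_simps)
      qed
    qed (use fwd(4) in blast)
    then have ends: "(lo k s = \<alpha> * lo i t + \<beta> \<and> up k s = \<alpha> * up i t + \<beta>) \<or>
      (lo k s = \<alpha> * up i t + \<beta> \<and> up k s = \<alpha> * lo i t + \<beta>)"
      using affine_interval_endpoints[OF \<alpha>, of "lo i t" "up i t" "lo k s" "up k s" \<beta>] mt ms by auto
    show ?thesis
    proof (rule that[OF \<alpha> sA ends])
      fix r assume r: "0 < r" "r < 1" "same_cell vs F (i, t) (i, r)"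
      have "r \<notin> marks vs F i"
        using r(3) mt marks_at_mark[OF assms(1), of r] by (auto simp: same_cell_def)
      then have "r \<in> {lo i t<..<up i t}" using r marks_strict[OF assms(1), of r] by (auto simp: same_cell_def)
      note f = fwd[OF this]
      have a: "lo k s \<in> marks vs F k" "up k s \<in> marks vs F k"
        using lower_mark(1) upper_mark(1) assms(2) s by simp_all
      have b: "lo k s < \<alpha> * r + \<beta>" "\<alpha> * r + \<beta> < up k s"
        using f(4) by simp_all
      have "\<not> (lo k s < m \<and> m < up k s)" if "m \<in> marks vs F k" for m
        using no_marks_between[OF assms(2) s _ _ sF] that by blast
      note marks_eqI[OF assms(2) a b this]
      then show "0 < \<alpha> * r + \<beta> \<and> \<alpha> * r + \<beta> < 1 \<and> chord vs u (pt vs i r) (pt vs k (\<alpha> * r + \<beta>)) \<and>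
         same_cell vs F (k, s) (k, \<alpha> * r + \<beta>)"
        using f(1-3) by (simp add: same_cell_def)
    qed
  qed
qed

end

text \<open>The distance to the centre of the cell, relative to its length.  For a point of \<open>F\<close> this is
  \<open>0 / 0 = 0\<close>.\<close>

definition eccentricity :: "(real^2) list \<Rightarrow> (real^2) set \<Rightarrow> nat \<times> real \<Rightarrow> real" where
  "eccentricity vs F = (\<lambda>(i, t). \<bar>2 * t - lower_mark vs F i t - upper_mark vs F i t\<bar> /
     (upper_mark vs F i t - lower_mark vs F i t))"

text \<open>True for c means reflection in the cell centre, False the identity. Naming the
  alternative, instead of stating a disjunction, makes it possible to say that it persists along the
  orbit.\<close>

definition cell_symmetric ::
  "(real^2) list \<Rightarrow> (real^2) set \<Rightarrow> bool \<Rightarrow> nat \<times> real \<Rightarrow> nat \<times> real \<Rightarrow> bool" where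
  "cell_symmetric vs F c p q \<longleftrightarrow> same_cell vs F p q \<and>
     (if c then snd p + snd q = lower_mark vs F (fst p) (snd p) + upper_mark vs F (fst p) (snd p)
      else snd p = snd q)"

lemma cell_symmetric_involutive:
  assumes "cell_symmetric vs F c p q" "cell_symmetric vs F c q r"
  shows "p = r"
  using assms by (cases p; cases q; cases r) (auto simp: cell_symmetric_def same_cell_def split: if_splits)

context marked_polygon
begin

lemma same_cell_cases:
  assumes "same_cell vs F p q" "eccentricity vs F p = eccentricity vs F q"
    "fst p < n" "0 < snd p" "snd p < 1" "0 < snd q" "snd q < 1"
  shows "\<exists>c. cell_symmetric vs F c p q"
proof -
  obtain i t r where pq: "p = (i, t)" "q = (i, r)"
    using assms(1) by (cases p; cases q) (auto simp: same_cell_def)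
  have ends: "lo i r = lo i t" "up i r = up i t" using assms(1) pq by (auto simp: same_cell_def)
  have "t = r \<or> t + r = lo i t + up i t"
  proof (cases "lo i t = up i t")
    \<comment> \<open>The quotient is 0 / 0 here and carries no information, but such a cell has
      only one point.\<close>
    case True
    then show ?thesis
      using lower_mark(2)[of i t] upper_mark(2)[of i t] lower_mark(2)[of i r] upper_mark(2)[of i r] assms pq ends
      by auto
  next
    case False
    then have "\<bar>2 * t - lo i t - up i t\<bar> = \<bar>2 * r - lo i t - up i t\<bar>"
      using assms(2) ends by (simp add: eccentricity_def pq)
    then show ?thesis by (auto simp: abs_eq_iff)
  qed
  then show ?thesis
  proof
    assume "t = r" then show ?thesis
      using assms(1) pq by (intro exI[of _ False]) (auto simp: cell_symmetric_def)
  next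
    assume "t + r = lo i t + up i t" then show ?thesis
      using assms(1) pq by (intro exI[of _ True]) (auto simp: cell_symmetric_def)
  qed
qed

text \<open>The start of a cell fixes its edge, because lower marks are below 1 here. What remains
  open is whether the cell is that start itself or the open interval after it, and the second
  hypothesis settles this.\<close>

lemma same_cellI:
  assumes "pt vs i (lo i t) = pt vs j (lo j r)" "t \<in> marks vs F i \<longleftrightarrow> r \<in> marks vs F j"
    "i < n" "j < n" "0 < t" "t < 1" "0 < r" "r < 1"
  shows "same_cell vs F (i, t) (j, r)"
proof -
  have "lo i t \<in> marks vs F i" "lo i t \<le> t" "lo j r \<in> marks vs F j" "lo j r \<le> r"
    using lower_mark assms by auto
  then have ij: "j = i" and l: "lo i t = lo i r"
    using pt_unique[OF assms(1,3,4)] assms by (auto simp: marks_def)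
  have "up i t = up i r"
  proof (cases "t \<in> marks vs F i")
    case True
    then show ?thesis using marks_at_mark assms ij l by metis
  next
    case False
    then have rF: "r \<notin> marks vs F i" using assms ij by simp
    note mt = marks_strict[OF assms(3,5,6) False] and mr = marks_strict[OF assms(3,7,8) rF]
    have u: "up i r \<in> marks vs F i" using upper_mark(1) assms by simp
    have "t < up i r"
      using lower_mark(3)[of i t "up i r"] u l mr assms by fastforce
    then show ?thesis
      using marks_eqI(2)[OF assms(3) _ u, of "lo i r" t] lower_mark(1)[of i r] l mt assms rF
        no_marks_between[OF assms(3,7,8) _ _ rF] by auto
  qed
  then show ?thesis using ij l by (simp add: same_cell_def)
qed

end

context filled_polygon
begin

text \<open>The offset from the centre and the cell length are both scaled by the absolute value of
  \<alpha>, even if the ends are swapped.\<close>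

lemma chord_eccentricity:
  assumes "i < n" "k < n" "0 < t" "t < 1" "0 < s" "s < 1" "chord vs u (pt vs i t) (pt vs k s)"
  shows "eccentricity vs F (k, s) = eccentricity vs F (i, t)"
proof -
  obtain \<alpha> \<beta> where *: "\<alpha> \<noteq> 0" "s = \<alpha> * t + \<beta>"
    "(lo k s = \<alpha> * lo i t + \<beta> \<and> up k s = \<alpha> * up i t + \<beta>) \<or>
     (lo k s = \<alpha> * up i t + \<beta> \<and> up k s = \<alpha> * lo i t + \<beta>)"
    using chord_carries_cell[OF assms] by metis
  have "2 * s - lo k s - up k s = \<alpha> * (2 * t - lo i t - up i t)"
    using * by (auto simp: algebra_simps)
  moreover have "\<bar>up k s - lo k s\<bar> = \<bar>\<alpha>\<bar> * \<bar>up i t - lo i t\<bar>"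
    using * by (auto simp: algebra_simps simp flip: abs_mult)
  moreover have "lo k s \<le> up k s" "lo i t \<le> up i t"
    using lower_mark(2) upper_mark(2) assms by (meson less_imp_le order_trans)+
  ultimately show ?thesis using *(1) by (simp add: eccentricity_def abs_mult)
qed

text \<open>Uniqueness of the chord forces the second one to follow the affine map of the first.
  That map carries centre to centre, so it commutes with the reflections.\<close>

lemma chord_carries_pair:
  assumes "i < n" "k < n" "0 < t" "t < 1" "0 < s" "s < 1" "chord vs u (pt vs i t) (pt vs k s)"
    and "i' < n" "k' < n" "0 < t'" "t' < 1" "0 < s'" "s' < 1" "chord vs u (pt vs i' t') (pt vs k' s')"
    and cell: "same_cell vs F (i, t) (i', t')"
  shows "same_cell vs F (k, s) (k', s')"
    "cell_symmetric vs F c (i, t) (i', t') \<Longrightarrow> cell_symmetric vs F c (k, s) (k', s')"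
proof -
  have i': "i' = i" using cell by (simp add: same_cell_def)
  obtain \<alpha> \<beta> where *: "s = \<alpha> * t + \<beta>"
    "(lo k s = \<alpha> * lo i t + \<beta> \<and> up k s = \<alpha> * up i t + \<beta>) \<or>
     (lo k s = \<alpha> * up i t + \<beta> \<and> up k s = \<alpha> * lo i t + \<beta>)"
    "\<And>r. 0 < r \<Longrightarrow> r < 1 \<Longrightarrow> same_cell vs F (i, t) (i, r) \<Longrightarrow>
       0 < \<alpha> * r + \<beta> \<and> \<alpha> * r + \<beta> < 1 \<and> chord vs u (pt vs i r) (pt vs k (\<alpha> * r + \<beta>)) \<and>
       same_cell vs F (k, s) (k, \<alpha> * r + \<beta>)"
    using chord_carries_cell[OF assms(1-7)] by metis
  note a = *(3)[OF assms(10,11) cell[unfolded i']]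
  then have "pt vs k' s' = pt vs k (\<alpha> * t' + \<beta>)"
    using chord_unique[OF assms(14) _ assms(8)] assms mem_edge[of i] i' by blast
  then have k': "k' = k" "s' = \<alpha> * t' + \<beta>"
    using pt_unique[of k' s' k "\<alpha> * t' + \<beta>"] a assms by auto
  then show 1: "same_cell vs F (k, s) (k', s')" using a by simp
  assume "cell_symmetric vs F c (i, t) (i', t')"
  then have r: "if c then t + t' = lo i t + up i t else t = t'" by (auto simp: cell_symmetric_def)
  have "lo k s + up k s = \<alpha> * (lo i t + up i t) + 2 * \<beta>" using *(2) by (auto simp: algebra_simps)
  moreover have "s + s' = \<alpha> * (t + t') + 2 * \<beta>" using k' *(1) by (simp add: algebra_simps)
  ultimately have "if c then s + s' = lo k s + up k s else s = s'"
    using r k'(2) *(1) by (cases c) simp_all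
  then show "cell_symmetric vs F c (k, s) (k', s')" using 1 by (simp add: cell_symmetric_def)
qed

end

section \<open>The billiard map on the phase space\<close>

locale polygon_pair =
  fixes W :: pair
  assumes polygons: "\<And>s. polygon (W s)"
begin

lemma hits_iff_chord:
  assumes "x \<in> poly_set (W s)" "j < length (W (opp s))" "y \<in> edge (W (opp s)) j"
  shows "hits W s x y z \<longleftrightarrow> chord (W s) (edge_vec (W (opp s)) j) x z"
proof -
  have "z \<in> {x + t |t. t \<in> L \<and> t \<noteq> 0} \<longleftrightarrow> z - x \<in> L \<and> x \<noteq> z" for L
    by (force intro: exI[of _ "z - x"])
  then show ?thesis
    unfolding hits_def chord_def polygon.tangent_line_eq[OF polygons assms(2,3)]
    using assms(1) by blast
qed

lemma P_max_edge:
  assumes "(s, x, y) \<in> P_max W"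
  obtains j t where "j < length (W (opp s))" "0 < t" "t < 1" "y = pt (W (opp s)) j t" "y \<in> edge (W (opp s)) j"
proof -
  have "y \<in> poly_set (W (opp s))" "y \<notin> set (W (opp s))"
    using assms by (auto simp: P_max_def condition_A_def)
  then show ?thesis
    using that polygon.poly_set_nonvertex[OF polygons] polygon.mem_edge[OF polygons] by metis
qed

lemma billiard_eq:
  assumes "(s, x, y) \<in> P_max W" "hits W s x y z"
  shows "billiard W (s, x, y) = (opp s, y, z)"
  using assms by (auto simp: P_max_def condition_A_def billiard_def intro: the1_equality)

lemma hits_ex: "(s, x, y) \<in> P_max W \<Longrightarrow> \<exists>z. hits W s x y z"
  by (auto simp: P_max_def condition_A_def)

text \<open>Existence and uniqueness of chords reduce condition A for nonvertex points to
  transversality of their edges.\<close>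

lemma P_maxI:
  assumes "i < length (W s)" "x \<in> edge (W s) i" "j < length (W (opp s))" "y \<in> edge (W (opp s)) j"
    and "cross2 (edge_vec (W s) i) (edge_vec (W (opp s)) j) \<noteq> 0"
  shows "(s, x, y) \<in> P_max W"
proof -
  interpret polygon "W s" by (rule polygons)
  interpret Q: polygon "W (opp s)" by (rule polygons)
  have x: "x \<in> poly_set (W s)" using edge_subset_poly_set assms by blast
  have "\<exists>!z. hits W s x y z"
    unfolding hits_iff_chord[OF x assms(3,4)]
    using chord_exists[OF assms(1,2,5)] chord_unique[OF _ _ assms(1,2)] by metis
  then show ?thesis
    using x assms Q.edge_subset_poly_set Q.vtx_notin_edge by (auto simp: P_max_def condition_A_def)
qed

lemma flip_flip: "flip (flip p) = p"
proof -
  have "opp (opp s) = s" for s by (cases s) auto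
  then show ?thesis by (auto simp: flip_def split: prod.splits)
qed

lemma mem_N_set_iff: "p \<in> N_set W \<longleftrightarrow> (\<exists>i. p \<in> N_step W i \<or> flip p \<in> N_step W i)"
proof -
  have "p \<in> flip ` A \<longleftrightarrow> flip p \<in> A" for A
    by (metis flip_flip image_eqI image_iff)
  then show ?thesis unfolding N_set_def by auto
qed

text \<open>The reversed state \<open>(s, z, y)\<close> is mapped to the reversal of \<open>(s, x, y)\<close>, so it cannot fall into
  the exceptional set either.\<close>

lemma phase_space_step:
  assumes p: "(s, x, y) \<in> phase_space W"
  obtains z where "billiard W (s, x, y) = (opp s, y, z)" "(opp s, y, z) \<in> phase_space W" "hits W s x y z"
proof -
  have pm: "(s, x, y) \<in> P_max W" and nN: "\<And>i. (s, x, y) \<notin> N_step W i" "\<And>i. flip (s, x, y) \<notin> N_step W i"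
    using p by (auto simp: phase_space_def mem_N_set_iff)
  have oo: "opp (opp s) = s" by (cases s) auto
  interpret polygon "W s" by (rule polygons)
  obtain z where z: "hits W s x y z" using hits_ex pm by blast
  have b: "billiard W (s, x, y) = (opp s, y, z)" using billiard_eq pm z by blast
  have x: "x \<in> poly_set (W s)" and y: "y \<in> poly_set (W (opp s))" using pm by (auto simp: P_max_def)
  obtain j where j: "j < length (W (opp s))" "y \<in> edge (W (opp s)) j" using P_max_edge[OF pm] by metis
  let ?d = "edge_vec (W (opp s)) j"
  have ch: "chord (W s) ?d x z" using hits_iff_chord[OF x j] z by simp
  then have zP: "z \<in> poly_set (W s)" by (simp add: chord_def)
  have nN': "(opp s, y, z) \<notin> N_step W i" for i
    using nN(1)[of "Suc i"] pm b by simp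
  have "z \<notin> set (W s)" using nN'[of 0] y zP oo by auto
  then obtain k where k: "k < length (W s)" "z \<in> edge (W s) k"
    using poly_set_nonvertex[OF zP] mem_edge by metis
  have "cross2 (edge_vec (W s) k) ?d \<noteq> 0"
    using chord_transversal[OF _ k] ch chord_sym by blast
  then have pm': "(opp s, y, z) \<in> P_max W"
    using P_maxI[of j "opp s" y k z] j k oo cross2_commute[of ?d "edge_vec (W s) k"] by simp
  have "(s, z, y) \<notin> N_step W i" for i
  proof (cases i)
    case 0 then show ?thesis using nN(1)[of 0] x by auto
  next
    case (Suc i')
    have "flip (s, x, y) \<in> N_step W i'" if "(s, z, y) \<in> N_step W i"
    proof -
      have "(s, z, y) \<in> P_max W" "billiard W (s, z, y) \<in> N_step W i'" using that Suc by auto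
      moreover have "hits W s z y x" using hits_iff_chord[OF zP j] ch chord_sym by blast
      ultimately show ?thesis using billiard_eq by (simp add: flip_def)
    qed
    then show ?thesis using nN by blast
  qed
  then have "(opp s, y, z) \<in> phase_space W"
    using pm' nN' oo by (auto simp: phase_space_def mem_N_set_iff flip_def)
  then show ?thesis using that b z by blast
qed

text \<open>Condition A keeps only y off the vertices; x is kept off them by the flipped half of
  \<open>N_set\<close>.\<close>

lemma phase_space_edges:
  assumes p: "(s, x, y) \<in> phase_space W"
  obtains i t where "i < length (W s)" "0 < t" "t < 1" "x = pt (W s) i t"
proof -
  have pm: "(s, x, y) \<in> P_max W" and nN: "\<And>i. flip (s, x, y) \<notin> N_step W i"
    using p by (auto simp: phase_space_def mem_N_set_iff)
  have "opp (opp s) = s" by (cases s) auto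
  then have "x \<in> poly_set (W s)" "x \<notin> set (W s)"
    using pm nN[of 0] by (auto simp: P_max_def flip_def)
  then show ?thesis using that polygon.poly_set_nonvertex[OF polygons] by metis
qed

text \<open>Consecutive states share a point, so the orbit is a single sequence. Points of equal
  parity lie on the same polygon and are linked by chords whose directions come from the other
  parity.\<close>

lemma orbit_coordinates:
  assumes "p \<in> phase_space W"
  obtains S E T where
    "\<And>k. (billiard W ^^ k) p = (S k, pt (W (S k)) (E k) (T k), pt (W (S (Suc k))) (E (Suc k)) (T (Suc k)))"
    "\<And>k. S (Suc k) = opp (S k)"
    "\<And>k. E k < length (W (S k))" "\<And>k. 0 < T k" "\<And>k. T k < 1"
    "\<And>k. chord (W (S k)) (edge_vec (W (S (Suc k))) (E (Suc k)))
       (pt (W (S k)) (E k) (T k)) (pt (W (S (Suc (Suc k)))) (E (Suc (Suc k))) (T (Suc (Suc k))))"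
proof -
  define q where "q k = (billiard W ^^ k) p" for k
  define S X where "S k = fst (q k)" and "X k = fst (snd (q k))" for k
  have q: "q k \<in> phase_space W" for k
  proof (induction k)
    case (Suc k)
    obtain s x y where k: "q k = (s, x, y)" by (cases "q k")
    then obtain z where "billiard W (s, x, y) = (opp s, y, z)" "(opp s, y, z) \<in> phase_space W"
      using phase_space_step Suc by metis
    then show ?case using k by (simp add: q_def)
  qed (simp add: q_def assms)
  have step: "q k = (S k, X k, X (Suc k)) \<and> S (Suc k) = opp (S k) \<and> hits W (S k) (X k) (X (Suc k)) (X (Suc (Suc k)))" for k
  proof -
    obtain s x y where k: "q k = (s, x, y)" by (cases "q k")
    have next_q: "q (Suc l) = billiard W (q l)" for l by (simp add: q_def)
    obtain z where z: "q (Suc k) = (opp s, y, z)" "hits W s x y z"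
      using phase_space_step q[of k] k next_q[of k] by metis
    obtain w where w: "q (Suc (Suc k)) = (opp (opp s), z, w)"
      using phase_space_step q[of "Suc k"] z(1) next_q[of "Suc k"] by metis
    show ?thesis using k z w by (simp add: S_def X_def)
  qed
  have "\<exists>i t. i < length (W (S k)) \<and> 0 < t \<and> t < 1 \<and> X k = pt (W (S k)) i t" for k
    using phase_space_edges[of "S k" "X k" "X (Suc k)"] q[of k] step[of k] by metis
  then obtain E T where ET: "\<And>k. E k < length (W (S k))" "\<And>k. 0 < T k" "\<And>k. T k < 1"
    "\<And>k. X k = pt (W (S k)) (E k) (T k)" by metis
  have ch: "chord (W (S k)) (edge_vec (W (S (Suc k))) (E (Suc k))) (X k) (X (Suc (Suc k)))" for k
  proof -
    have "X k \<in> poly_set (W (S k))"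
      using ET polygon.pt_in_poly_set[OF polygons] by (simp add: less_imp_le)
    moreover have "X (Suc k) \<in> edge (W (S (Suc k))) (E (Suc k))"
      using ET polygon.mem_edge[OF polygons] by blast
    ultimately show ?thesis
      using step[of k] hits_iff_chord[of "X k" "S k" "E (Suc k)" "X (Suc k)" "X (Suc (Suc k))"] ET(1)[of "Suc k"]
      by simp
  qed
  show ?thesis
    by (rule that[of S E T]) (use step ET ch in \<open>simp_all add: q_def\<close>)
qed

end

section \<open>Repetition of labels and closing of the orbit\<close>

lemma UNIV_sign: "(UNIV :: sign set) = {Minus, Plus}"
  using sign.exhaust by auto

locale finitely_filled_pair = polygon_pair +
  assumes finite_filled: "finite (filled W)"
begin

lemma finite_filled_part: "finite (filled_part W s)"
proof -
  have "filled_part W s \<subseteq> snd ` filled W" by (force simp: filled_def)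
  then show ?thesis using finite_filled finite_subset by blast
qed

lemma filled_polygon_edge:
  assumes "j < length (W (opp s))"
  shows "filled_polygon (W s) (filled_part W s) (edge_vec (W (opp s)) j)"
proof -
  interpret polygon "W s" by (rule polygons)
  show ?thesis
  proof
    show "finite (filled_part W s)" by (rule finite_filled_part)
    show "set (W s) \<subseteq> filled_part W s"
      unfolding filled_part_def by (metis UN_upper UNIV_I V_step.simps(1))
    fix x z assume c: "chord (W s) (edge_vec (W (opp s)) j) x z" and "x \<in> filled_part W s"
    then obtain i where "x \<in> V_step W s i" by (auto simp: filled_part_def)
    then have "z \<in> V_step W s (Suc i)"
      using c[unfolded chord_sym[of _ _ x]] assms by (auto simp: chord_def)
    then show "z \<in> filled_part W s" unfolding filled_part_def by blast
  qed
qed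

text \<open>A state is recorded by its sign and, for each of its two points, the last filled point before it
  on its edge.  Two states of equal record whose points are both filled or both unfilled in each
  component lie in the same product of cells, and the billiard map acts injectively on these.\<close>

lemma orbit_returns:
  assumes "p \<in> phase_space W"
  shows "\<exists>N\<ge>1. N \<le> 4 * card (filled_part W Minus) * card (filled_part W Plus) \<and> (billiard W ^^ N) p = p"
proof -
  define F where "F = filled_part W"
  obtain S E T where orb:
    "\<And>k. (billiard W ^^ k) p = (S k, pt (W (S k)) (E k) (T k), pt (W (S (Suc k))) (E (Suc k)) (T (Suc k)))"
    and S: "\<And>k. S (Suc k) = opp (S k)"
    and E: "\<And>k. E k < length (W (S k))" and T: "\<And>k. 0 < T k" "\<And>k. T k < 1"
    and ch: "\<And>k. chord (W (S k)) (edge_vec (W (S (Suc k))) (E (Suc k)))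
       (pt (W (S k)) (E k) (T k)) (pt (W (S (Suc (Suc k)))) (E (Suc (Suc k))) (T (Suc (Suc k))))"
    using orbit_coordinates[OF assms] by metis
  have oo: "opp (opp s) = s" "opp s \<noteq> s" for s by (cases s; simp)+
  have S2: "S (Suc (Suc k)) = S k" for k using S oo by simp
  have fp: "filled_polygon (W (S k)) (F (S k)) (edge_vec (W (S (Suc k))) (E (Suc k)))" for k
    using filled_polygon_edge[of "E (Suc k)" "S k"] E[of "Suc k"] S by (simp add: F_def)
  have mp: "marked_polygon (W (S k)) (F (S k))" for k
    using fp[of k] by (simp add: filled_polygon_def marked_polygon_def filled_polygon_axioms_def marked_polygon_axioms_def)
  have ch': "chord (W (S k)) (edge_vec (W (S (Suc k))) (E (Suc k)))
       (pt (W (S k)) (E k) (T k)) (pt (W (S k)) (E (Suc (Suc k))) (T (Suc (Suc k))))" for k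
    using ch[of k] S2[of k] by simp
  have E': "E (Suc (Suc k)) < length (W (S k))" for k using E[of "Suc (Suc k)"] S2[of k] by simp

  define C where "C k l \<longleftrightarrow> S k = S l \<and> same_cell (W (S k)) (F (S k)) (E k, T k) (E l, T l)" for k l
  define D where "D c k l \<longleftrightarrow> S k = S l \<and> cell_symmetric (W (S k)) (F (S k)) c (E k, T k) (E l, T l)" for c k l
  define e where "e k = eccentricity (W (S k)) (F (S k)) (E k, T k)" for k
  define filledp where "filledp k \<longleftrightarrow> T k \<in> marks (W (S k)) (F (S k)) (E k)" for k

  have e2: "e (Suc (Suc k)) = e k" for k
    unfolding e_def S2
    by (rule filled_polygon.chord_eccentricity[OF fp E E' T T ch'])
  have f2: "filledp (Suc (Suc k)) = filledp k" for k
    using filled_polygon.chord_F_iff[OF fp ch'] T[of k] T[of "Suc (Suc k)"]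
    by (simp add: filledp_def marks_def S2)

  have next_same: "C (Suc (Suc k)) (Suc (Suc l))" and next_sym: "D c k l \<Longrightarrow> D c (Suc (Suc k)) (Suc (Suc l))"
    if "C k l" "C (Suc k) (Suc l)" for c k l
  proof -
    \<comment> \<open>The middle points share a cell and thus an edge, so both chords have the same
      direction.\<close>
    have Skl: "S l = S k" "S (Suc l) = S (Suc k)" and El: "E (Suc l) = E (Suc k)"
      using that by (auto simp: C_def same_cell_def)
    note cl = ch'[of l, unfolded Skl El]
    note * = filled_polygon.chord_carries_pair[OF fp E E' T T ch' E[of l, unfolded Skl] E'[of l, unfolded Skl] T T cl]
    show "C (Suc (Suc k)) (Suc (Suc l))" "D c k l \<Longrightarrow> D c (Suc (Suc k)) (Suc (Suc l))"
      using * that by (auto simp: C_def D_def S2 Skl)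
  qed
  \<comment> \<open>Injectivity on pairs of cells: the same transport along the reversed
    chords.\<close>
  have prev_same: "C k l" if "C (Suc k) (Suc l)" "C (Suc (Suc k)) (Suc (Suc l))" for k l
  proof -
    have Skl: "S l = S k" "S (Suc l) = S (Suc k)" and El: "E (Suc l) = E (Suc k)"
      using that S2 by (auto simp: C_def same_cell_def)
    note ck = ch'[of k, unfolded chord_sym[of _ _ "pt (W (S k)) (E k) (T k)"]]
    note cl = ch'[of l, unfolded chord_sym[of _ _ "pt (W (S l)) (E l) (T l)"], unfolded Skl El]
    note * = filled_polygon.chord_carries_pair(1)[OF fp E' E T T ck E'[of l, unfolded Skl] E[of l, unfolded Skl] T T cl]
    show "C k l" using * that by (auto simp: C_def S2 Skl)
  qed

  \<comment> \<open>The number of labels: two signs, each with one filled point from either polygon.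
    The K + 1 times from 0 to K must therefore repeat a label.\<close>
  define K where "K = 2 * card (F Minus) * card (F Plus)"
  define G where "G k = pt (W (S k)) (E k) (lower_mark (W (S k)) (F (S k)) (E k) (T k))" for k
  define L where "L k = (S k, G k, G (Suc k))" for k
  define Lab where "Lab = (SIGMA s:UNIV. F s \<times> F (opp s))"
  have fF: "finite (F s)" for s by (simp add: F_def finite_filled_part)
  have finLab: "finite Lab" unfolding Lab_def UNIV_sign using fF by (intro finite_SigmaI) auto
  have "card Lab = K"
    unfolding Lab_def UNIV_sign K_def using fF by (subst card_SigmaI) (auto simp: card_cartesian_product)
  have G_F: "G k \<in> F (S k)" for k
    using marked_polygon.lower_mark(1)[OF mp E less_imp_le[OF T(1)]] by (simp add: marks_def G_def)
  have "L ` {..K} \<subseteq> Lab"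
  proof
    fix x assume "x \<in> L ` {..K}"
    then obtain k where "x = L k" by blast
    then show "x \<in> Lab" using G_F[of k] G_F[of "Suc k"] S[of k] by (simp add: L_def Lab_def)
  qed
  then have "card (L ` {..K}) \<le> K" using \<open>card Lab = K\<close> card_mono[OF finLab] by metis
  then have "\<not> inj_on L {..K}" using card_image[of L "{..K}"] by auto
  then obtain a b where ab: "a < b" "b \<le> K" "L a = L b"
    by (metis atMost_iff inj_onI linorder_neqE_nat)
  have C_label: "C k l" if "S k = S l" "filledp k = filledp l" "G k = G l" for k l
    unfolding C_def
    using marked_polygon.same_cellI[OF mp[of k], of "E k" "T k" "E l" "T l"] that E[of k] E[of l] T
    by (simp add: filledp_def G_def)
  define m where "m = b - a"
  have m: "1 \<le> m" "m \<le> K" "b = a + m" using ab by (auto simp: m_def)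
  have Sk: "S k = (if even k then S 0 else opp (S 0))" for k
    by (induction k) (auto simp: S oo)
  have "S a = S b" using ab by (simp add: L_def)
  then have "even m" using Sk[of a] Sk[of b] oo(2)[of "S 0"] m(3) by (auto split: if_splits)
  have even_shift: "f (k + j) = f k" if j: "even j" and f: "\<And>k. f (Suc (Suc k)) = f k" for f :: "nat \<Rightarrow> 'z" and k j
  proof -
    obtain q where "j = 2 * q" using j by blast
    then show ?thesis by (induction q arbitrary: j) (auto simp: f)
  qed
  \<comment> \<open>This supplies the filledness that the label omits, so that equal labels do mean
    equal cells.\<close>
  have filled_m: "filledp (k + m) = filledp k" for k using even_shift[OF \<open>even m\<close>, of filledp] f2 by blast
  have e_m: "e (k + m) = e k" for k using even_shift[OF \<open>even m\<close>, of e] e2 by blast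
  have Ca: "C a (a + m) \<and> C (Suc a) (Suc (a + m))"
    using C_label[of a "a + m"] C_label[of "Suc a" "Suc (a + m)"] ab(3) filled_m[of a] filled_m[of "Suc a"]
    by (simp add: L_def m(3) S)
  \<comment> \<open>Downward from the time a of the repetition to the start of the orbit.\<close>
  have "C j (j + m) \<and> C (Suc j) (Suc (j + m))" if "j \<le> a" for j
    using that
  proof (induction rule: inc_induct)
    case (step j)
    then show ?case using prev_same[of j "j + m"] by simp
  qed (rule Ca)
  then have C0: "C 0 m" "C 1 (Suc m)" by force+
  have Call: "C k (k + m) \<and> C (Suc k) (Suc (k + m))" for k
  proof (induction k)
    case 0 show ?case using C0 by simp
  next
    case (Suc k) then show ?case using next_same[of k "k + m"] by simp
  qed
  have D_shift: "D c (k + 2 * q) (k + 2 * q + m)" if "D c k (k + m)" for c k q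
  proof (induction q)
    case (Suc q)
    then show ?case using next_sym[of "k + 2 * q" "k + 2 * q + m" c] Call[of "k + 2 * q"] by simp
  qed (use that in simp)
  have return: "S (k + 2 * m) = S k \<and> E (k + 2 * m) = E k \<and> T (k + 2 * m) = T k" for k
  proof -
    have c: "S k = S (k + m)" "same_cell (W (S k)) (F (S k)) (E k, T k) (E (k + m), T (k + m))"
      using Call[of k] by (auto simp: C_def)
    have "eccentricity (W (S k)) (F (S k)) (E k, T k) = eccentricity (W (S k)) (F (S k)) (E (k + m), T (k + m))"
      using e_m[of k] c(1) by (simp add: e_def)
    then obtain c where 1: "D c k (k + m)"
      using marked_polygon.same_cell_cases[OF mp c(2)] E[of k] T c(1) unfolding D_def by auto
    \<comment> \<open>A chord advances the index by 2, so q chords carry the alternative c from the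
      times k, k + m to k + m, k + 2 m. Used twice, c cancels.\<close>
    moreover obtain q where "m = 2 * q" using \<open>even m\<close> by blast
    ultimately have 2: "D c (k + m) (k + m + m)" using D_shift[of c k q] by simp
    show ?thesis
      using 1 2 cell_symmetric_involutive[of "W (S k)" "F (S k)" c "(E k, T k)" "(E (k + m), T (k + m))" "(E (k + m + m), T (k + m + m))"]
      by (auto simp: D_def mult_2 add.assoc)
  qed
  have "(billiard W ^^ (2 * m)) p = p"
    using orb[of "2 * m"] orb[of 0] return[of 0] return[of 1] by simp
  moreover have "2 * m \<le> 4 * card (filled_part W Minus) * card (filled_part W Plus)"
    using m(2) by (simp add: K_def F_def)
  ultimately show ?thesis using m(1) by (intro exI[of _ "2 * m"]) auto
qed

end

theorem theorem3p1:
  fixes W :: "sign \<Rightarrow> (real^2) list"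
  assumes "is_polygon (W Minus)" and "is_polygon (W Plus)"
    and "finite (filled W)"
  shows "\<forall>p \<in> phase_space W. periodic_orbit W p \<and>
           orbit_period W p \<le> 4 * card (filled_part W Minus) * card (filled_part W Plus)"
proof
  fix p assume p: "p \<in> phase_space W"
  have "polygon (W s)" for s using assms by (cases s) (auto intro: polygon.intro)
  then interpret finitely_filled_pair W
    using assms(3)
    by (intro finitely_filled_pair.intro polygon_pair.intro finitely_filled_pair_axioms.intro)
  obtain N where N: "1 \<le> N" "N \<le> 4 * card (filled_part W Minus) * card (filled_part W Plus)"
    "(billiard W ^^ N) p = p" using orbit_returns[OF p] by blast
  then have "orbit_period W p \<le> N" unfolding orbit_period_def by (intro Least_le) simp
  then show "periodic_orbit W p \<and> orbit_period W p \<le> 4 * card (filled_part W Minus) * card (filled_part W Plus)"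
    using N by (auto simp: periodic_orbit_def)
qed

end
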